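(* There exists a separable compact space $L$ such that $L$ does not have the Grothendieck property but it has the $\ell_1$-Grothendieck property.
   Context: All compact spaces are Hausdorff. A measure on $L$ is a signed $\sigma$-additive Radon measure on the Borel $\sigma$-algebra of $L$; $\ell_1(L)$ is the space of all countably supported measures on $L$ (of the form $\sum_x\alpha_x\delta_x$ with $\sum_x|\alpha_x|<\infty$). A sequence of measures $\mu_n$ on $L$ is weakly* convergent to $\mu$ if $\int_L f\,d\mu_n\to\int_L f\,d\mu$ for every $f\in C(L)$, and weakly convergent to $\mu$ if $\mu_n(B)\to\mu(B)$ for every Borel $B\subseteq L$. $L$ has the Grothendieck property if every weakly* convergent sequence of measures on $L$ is weakly convergent; $L$ has the $\ell_1$-Grothendieck property if every weakly* convergent sequence of measures from $\ell_1(L)$ is weakly convergent. *)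

theory Defs
  imports "HOL-Analysis.Analysis"
begin

definition borel_sets_of :: "'a topology \<Rightarrow> 'a set set" where
  "borel_sets_of L = sigma_sets (topspace L) {U. openin L U}"

text \<open>A signed measure is a real-valued (hence finite) set function. Values on non-Borel sets are
  unconstrained, and nothing below depends on them.\<close>

definition signed_borel_measure :: "'a topology \<Rightarrow> ('a set \<Rightarrow> real) \<Rightarrow> bool" where
  "signed_borel_measure L \<mu> \<longleftrightarrow>
     \<mu> {} = 0 \<and>
     (\<forall>A::nat \<Rightarrow> 'a set. range A \<subseteq> borel_sets_of L \<longrightarrow> disjoint_family A \<longrightarrow>
        (\<lambda>i. \<mu> (A i)) sums \<mu> (\<Union>i. A i))"

text \<open>The Jordan decomposition \<open>\<mu> = \<mu>\<^sup>+ - \<mu>\<^sup>-\<close>, with \<open>\<mu>\<^sup>- = (- \<mu>)\<^sup>+\<close> and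
  \<open>\<bar>\<mu>\<bar> = \<mu>\<^sup>+ + \<mu>\<^sup>-\<close>. A real-valued signed measure is bounded, so the suprema are finite.\<close>

definition pos_variation :: "'a topology \<Rightarrow> ('a set \<Rightarrow> real) \<Rightarrow> 'a set \<Rightarrow> real" where
  "pos_variation L \<mu> B = (SUP C\<in>{C \<in> borel_sets_of L. C \<subseteq> B}. \<mu> C)"

definition neg_variation :: "'a topology \<Rightarrow> ('a set \<Rightarrow> real) \<Rightarrow> 'a set \<Rightarrow> real" where
  "neg_variation L \<mu> = pos_variation L (\<lambda>B. - \<mu> B)"

definition total_variation :: "'a topology \<Rightarrow> ('a set \<Rightarrow> real) \<Rightarrow> 'a set \<Rightarrow> real" where
  "total_variation L \<mu> B = pos_variation L \<mu> B + neg_variation L \<mu> B"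

definition radon_measure :: "'a topology \<Rightarrow> ('a set \<Rightarrow> real) \<Rightarrow> bool" where
  "radon_measure L \<mu> \<longleftrightarrow>
     signed_borel_measure L \<mu> \<and>
     (\<forall>B\<in>borel_sets_of L. \<forall>e>0. \<exists>K. compactin L K \<and> K \<subseteq> B \<and> total_variation L \<mu> (B - K) < e)"

definition signed_integral :: "'a topology \<Rightarrow> ('a set \<Rightarrow> real) \<Rightarrow> ('a \<Rightarrow> real) \<Rightarrow> real" where
  "signed_integral L \<mu> f =
     (LINT x|measure_of (topspace L) (borel_sets_of L) (\<lambda>B. ennreal (pos_variation L \<mu> B)). f x) -
     (LINT x|measure_of (topspace L) (borel_sets_of L) (\<lambda>B. ennreal (neg_variation L \<mu> B)). f x)"

text \<open>Absolute summability of \<open>\<alpha>\<close> forces all but countably many coefficients to vanish.\<close>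

definition l1_measure :: "'a topology \<Rightarrow> ('a set \<Rightarrow> real) \<Rightarrow> bool" where
  "l1_measure L \<mu> \<longleftrightarrow>
     radon_measure L \<mu> \<and>
     (\<exists>\<alpha>. (\<lambda>x. \<bar>\<alpha> x\<bar>) summable_on topspace L \<and>
        (\<forall>B\<in>borel_sets_of L. \<mu> B = (\<Sum>\<^sub>\<infinity>x\<in>topspace L. \<alpha> x * indicator B x)))"

definition weakstar_convergent_to ::
  "'a topology \<Rightarrow> (nat \<Rightarrow> 'a set \<Rightarrow> real) \<Rightarrow> ('a set \<Rightarrow> real) \<Rightarrow> bool" where
  "weakstar_convergent_to L \<mu>s \<mu> \<longleftrightarrow>
     (\<forall>f. continuous_map L euclideanreal f \<longrightarrow>
        (\<lambda>n. signed_integral L (\<mu>s n) f) \<longlonglongrightarrow> signed_integral L \<mu> f)"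

definition weakly_convergent_to ::
  "'a topology \<Rightarrow> (nat \<Rightarrow> 'a set \<Rightarrow> real) \<Rightarrow> ('a set \<Rightarrow> real) \<Rightarrow> bool" where
  "weakly_convergent_to L \<mu>s \<mu> \<longleftrightarrow> (\<forall>B\<in>borel_sets_of L. (\<lambda>n. \<mu>s n B) \<longlonglongrightarrow> \<mu> B)"

definition weakstar_convergent :: "'a topology \<Rightarrow> (nat \<Rightarrow> 'a set \<Rightarrow> real) \<Rightarrow> bool" where
  "weakstar_convergent L \<mu>s \<longleftrightarrow> (\<exists>\<mu>. radon_measure L \<mu> \<and> weakstar_convergent_to L \<mu>s \<mu>)"

definition weakly_convergent :: "'a topology \<Rightarrow> (nat \<Rightarrow> 'a set \<Rightarrow> real) \<Rightarrow> bool" where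
  "weakly_convergent L \<mu>s \<longleftrightarrow> (\<exists>\<mu>. radon_measure L \<mu> \<and> weakly_convergent_to L \<mu>s \<mu>)"

definition grothendieck_property :: "'a topology \<Rightarrow> bool" where
  "grothendieck_property L \<longleftrightarrow>
     (\<forall>\<mu>s. (\<forall>n. radon_measure L (\<mu>s n)) \<longrightarrow> weakstar_convergent L \<mu>s \<longrightarrow> weakly_convergent L \<mu>s)"

text \<open>Only the members of the sequence are required to lie in \<open>\<ell>\<^sub>1(L)\<close>, not its limit.\<close>

definition l1_grothendieck_property :: "'a topology \<Rightarrow> bool" where
  "l1_grothendieck_property L \<longleftrightarrow>
     (\<forall>\<mu>s. (\<forall>n. l1_measure L (\<mu>s n)) \<longrightarrow> weakstar_convergent L \<mu>s \<longrightarrow> weakly_convergent L \<mu>s)"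

text \<open>A separable Hausdorff space has at most \<open>2^(2^\<aleph>\<^sub>0)\<close> points (send \<open>x\<close> to the family of traces
  of its neighbourhoods on a countable dense set), so up to homeomorphism every separable compact
  Hausdorff space occurs among the topologies of type \<^typ>\<open>nat set set topology\<close>, whose carriers
  may be arbitrary subsets of \<^typ>\<open>nat set set\<close>. Existence of a space may therefore be
  stated over this type without loss of generality.\<close>

end

theory Submission
  imports Defs
begin

text \<open>
  The space is the Stone space of an algebra of sets of natural numbers. Code the natural numbers as
  countably many \<^emph>\<open>fibres\<close>, each of them split into two copies of the natural numbers, and fix a
  finitely additive density on all sets of natural numbers that gives each residue class
  modulo \<open>m\<close> at most the value \<open>1/m\<close>. A set is \<^emph>\<open>balanced\<close> if the density of the symmetric
  difference of its traces on the two copies in the \<open>n\<close>-th fibre tends to \<open>0\<close> with \<open>n\<close>. Balanced sets form an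
  algebra. Its Stone space is compact and Hausdorff, and the principal ultrafilters are dense in it.

  It does not have the Grothendieck property. Let \<open>\<nu>\<^sub>n\<close> be the Radon measure on the Stone space that
  extends the difference of the densities on the two copies of fibre \<open>n\<close>. By definition of
  balance \<open>\<nu>\<^sub>n\<close> tends to \<open>0\<close> on every clopen set, and since the \<open>\<nu>\<^sub>n\<close> have bounded norm, they tend
  to \<open>0\<close> weakly*. On the other hand, let \<open>h\<^sub>i\<close> be the clopen set of the first copy of fibre \<open>i\<close>. Then
  \<open>\<nu>\<^sub>n h\<^sub>i\<close> is \<open>1\<close> if \<open>n = i\<close> and \<open>0\<close> otherwise, so a weak limit would vanish on each of the
  disjoint sets \<open>h\<^sub>i\<close> and take the value \<open>1\<close> on their union.

  It does have the \<open>\<ell>\<^sub>1\<close>-Grothendieck property, because atomic measures can be tested on sets that are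
  uniformly small in density, and with small sets the algebra is rich. Every point has
  neighbourhoods of arbitrarily small density in all fibres at once. If \<open>a\<^sub>k\<close> are disjoint balanced sets of
  density at most \<open>2\<^sup>-\<^sup>k\<close> in every fibre, then for suitable infinite \<open>M\<close> the union of the \<open>a\<^sub>k\<close> with \<open>k \<in> M\<close> is
  again balanced; countable additivity of the density may fail for a given \<open>M\<close>, but along an uncountable
  almost disjoint family it can fail, in some fibre, for countably many \<open>M\<close> only. For
  the same reason \<open>M\<close> can be chosen such that, within a given countable set of points, the clopen set of the union
  has no points other than those of the clopen sets of the \<open>a\<^sub>k\<close> (\<open>thin_union_selection\<close>).

  Such an algebra admits a gliding hump argument (\<open>normalized_null_sequence_contradiction\<close>): a
  sequence in \<open>\<ell>\<^sub>1\<close> with norms \<open>1\<close> cannot tend to \<open>0\<close> on all clopen sets, for one finds disjoint small clopen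
  sets \<open>a\<^sub>k\<close> that carry humps of a subsequence, and the clopen set of the union of infinitely many of them catches
  infinitely many humps. Applied to normalized differences, this shows that a
  sequence in \<open>\<ell>\<^sub>1\<close> that converges on every clopen set converges in norm
  (\<open>setwise_convergent_imp_norm_convergent\<close>), in particular on every Borel set.
\<close>

section \<open>Ultrafilters\<close>

definition ultra :: "'a filter \<Rightarrow> bool" where
  "ultra G \<longleftrightarrow> G \<noteq> bot \<and> (\<forall>P. eventually P G \<or> eventually (\<lambda>x. \<not> P x) G)"

text \<open>
  Zorn's lemma, applied to the families of eventually true predicates: the infimum of a chain of
  proper filters is proper because it is eventually decided by a single member.
\<close>

lemma ultra_refines:
  fixes F :: "'a filter"
  assumes "F \<noteq> bot"
  obtains G where "ultra G" "G \<le> F"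
proof -
  define ev where "ev = (\<lambda>G :: 'a filter. {P. eventually P G})"
  have ev_le: "ev G \<subseteq> ev H \<longleftrightarrow> H \<le> G" for G H
    by (auto simp: ev_def le_filter_def)
  define \<A> where "\<A> = ev ` {G. G \<noteq> bot \<and> G \<le> F}"
  have "\<exists>M\<in>\<A>. \<forall>X\<in>\<A>. M \<subseteq> X \<longrightarrow> X = M"
  proof (rule subset_Zorn_nonempty)
    show "\<A> \<noteq> {}" using assms by (auto simp: \<A>_def)
  next
    fix \<C> assume ne: "\<C> \<noteq> {}" and ch: "subset.chain \<A> \<C>"
    define B where "B = {G. G \<noteq> bot \<and> G \<le> F \<and> ev G \<in> \<C>}"
    have \<C>_eq: "\<C> = ev ` B"
      using ch by (auto simp: B_def \<A>_def subset_chain_def)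
    have evI: "eventually P (Inf B) \<longleftrightarrow> (\<exists>b\<in>B. eventually P b)" for P
    proof (rule eventually_Inf_base)
      show "B \<noteq> {}" using ne \<C>_eq by auto
      fix a b assume "a \<in> B" "b \<in> B"
      then have "ev a \<subseteq> ev b \<or> ev b \<subseteq> ev a"
        using ch by (auto simp: B_def subset_chain_def)
      then show "\<exists>x\<in>B. x \<le> inf a b"
        unfolding ev_le using \<open>a \<in> B\<close> \<open>b \<in> B\<close> by (metis inf.absorb1 inf.absorb2 order_refl)
    qed
    have "\<Union>\<C> = ev (Inf B)"
      unfolding \<C>_eq by (auto simp: ev_def evI)
    moreover have "Inf B \<noteq> bot"
    proof
      assume "Inf B = bot"
      then have "\<exists>b\<in>B. eventually (\<lambda>_. False) b" by (simp flip: evI)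
      then show False by (auto simp: B_def trivial_limit_def)
    qed
    moreover have "Inf B \<le> F"
    proof -
      obtain G where "G \<in> B" using ne \<C>_eq by auto
      then show ?thesis using Inf_lower[of G B] by (auto simp: B_def intro: order_trans)
    qed
    ultimately show "\<Union>\<C> \<in> \<A>" by (auto simp: \<A>_def)
  qed
  then obtain G where G: "G \<noteq> bot" "G \<le> F"
    and max: "\<And>H. H \<noteq> bot \<Longrightarrow> H \<le> F \<Longrightarrow> ev G \<subseteq> ev H \<Longrightarrow> ev H = ev G"
    unfolding \<A>_def by auto
  have "eventually P G \<or> eventually (\<lambda>x. \<not> P x) G" for P
  proof (rule disjCI)
    assume "\<not> eventually (\<lambda>x. \<not> P x) G"
    then have "inf G (principal {x. P x}) \<noteq> bot"
      by (auto simp: trivial_limit_def eventually_inf_principal)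
    with max[of "inf G (principal {x. P x})"] G have "ev (inf G (principal {x. P x})) = ev G"
      by (auto simp: ev_le intro: le_infI1)
    moreover have "P \<in> ev (inf G (principal {x. P x}))"
      by (simp add: ev_def eventually_inf_principal)
    ultimately show "eventually P G" by (simp add: ev_def)
  qed
  with G show thesis by (intro that) (auto simp: ultra_def)
qed

lemma ultra_bounded_tendsto:
  fixes f :: "'a \<Rightarrow> real"
  assumes "ultra G" "\<And>x. f x \<in> {a..b}"
  obtains l where "l \<in> {a..b}" "(f \<longlongrightarrow> l) G"
proof -
  have nb: "filtermap f G \<noteq> bot" using assms by (auto simp: ultra_def filtermap_bot_iff)
  have "eventually (\<lambda>x. x \<in> {a..b}) (filtermap f G)"
    using assms(2) by (simp add: eventually_filtermap)
  with compact_Icc[of a b] nb obtain l where l: "l \<in> {a..b}" "inf (nhds l) (filtermap f G) \<noteq> bot"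
    unfolding compact_filter by blast
  have "eventually (\<lambda>x. f x \<in> S) G" if "open S" "l \<in> S" for S
  proof (rule ccontr)
    assume "\<not> eventually (\<lambda>x. f x \<in> S) G"
    then have "eventually (\<lambda>x. f x \<notin> S) G" using assms(1) by (auto simp: ultra_def)
    then have "eventually (\<lambda>y. y \<notin> S) (filtermap f G)" by (simp add: eventually_filtermap)
    moreover have "eventually (\<lambda>y. y \<in> S) (nhds l)" using that by (auto simp: eventually_nhds)
    ultimately have "eventually (\<lambda>_. False) (inf (nhds l) (filtermap f G))"
      unfolding eventually_inf by blast
    with l(2) show False by (simp add: trivial_limit_def)
  qed
  then have "(f \<longlongrightarrow> l) G" by (simp add: tendsto_def)
  with l show thesis by (intro that)
qed

section \<open>Signed measures with a Hahn set\<close>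

lemma borel_sets_of_subset: "B \<in> borel_sets_of L \<Longrightarrow> B \<subseteq> topspace L"
  unfolding borel_sets_of_def
  using sigma_sets_into_sp[of "{U. openin L U}" "topspace L"] openin_subset by blast

lemma sigma_algebra_borel_sets_of: "sigma_algebra (topspace L) (borel_sets_of L)"
  unfolding borel_sets_of_def by (rule sigma_algebra_sigma_sets) (use openin_subset in auto)

lemma signed_borel_measure_sums:
  assumes "signed_borel_measure L \<mu>" "range A \<subseteq> borel_sets_of L" "disjoint_family (A :: nat \<Rightarrow> _)"
  shows "(\<lambda>i. \<mu> (A i)) sums \<mu> (\<Union>i. A i)"
  using assms by (simp add: signed_borel_measure_def)

text \<open>
  The Hahn set \<open>H\<close> makes \<open>P\<close> and \<open>N\<close> mutually singular, so \<open>\<mu> = P - N\<close> is a Jordan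
  decomposition and the variations, which are suprema over Borel sets, can be computed.
\<close>

locale hahn_pair = P: finite_measure P + N: finite_measure N for P N :: "'a measure" +
  fixes L :: "'a topology" and H :: "'a set" and \<mu> :: "'a set \<Rightarrow> real"
  assumes sets_P: "sets P = borel_sets_of L" and sets_N: "sets N = borel_sets_of L"
    and H: "H \<in> borel_sets_of L" "measure N H = 0" "measure P (topspace L - H) = 0"
    and \<mu>: "\<And>B. B \<in> borel_sets_of L \<Longrightarrow> \<mu> B = measure P B - measure N B"
begin

text \<open>
  Passing to \<open>- \<mu>\<close> exchanges the two measures; this turns statements on the positive
  variation into statements on the negative one.
\<close>

lemma swap: "hahn_pair N P L (topspace L - H) (\<lambda>B. - \<mu> B)"
proof -
  interpret sigma_algebra "topspace L" "borel_sets_of L" by (rule sigma_algebra_borel_sets_of)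
  have "topspace L - (topspace L - H) = H" using H(1) borel_sets_of_subset by blast
  then show ?thesis
    using H sets_P sets_N \<mu> P.finite_measure_axioms N.finite_measure_axioms
    by unfold_locales auto
qed

lemma space_P: "space P = topspace L" 
proof -
  interpret sigma_algebra "topspace L" "borel_sets_of L" by (rule sigma_algebra_borel_sets_of)
  show ?thesis using sets_P by (metis borel_sets_of_subset sets.sets_into_space sets.top subset_antisym top)
qed

lemma signed_borel_measure: "signed_borel_measure L \<mu>"
  unfolding signed_borel_measure_def
proof (intro conjI allI impI)
  interpret sigma_algebra "topspace L" "borel_sets_of L" by (rule sigma_algebra_borel_sets_of)
  show "\<mu> {} = 0" using \<mu>[of "{}"] by simp
  fix A :: "nat \<Rightarrow> 'a set" assume A: "range A \<subseteq> borel_sets_of L" "disjoint_family A"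
  have "(\<lambda>i. measure P (A i) - measure N (A i)) sums (measure P (\<Union>i. A i) - measure N (\<Union>i. A i))"
    using A by (intro sums_diff P.finite_measure_UNION N.finite_measure_UNION)
      (auto simp: sets_P sets_N)
  moreover have "(\<Union>i. A i) \<in> borel_sets_of L" using A by auto
  moreover have "A i \<in> borel_sets_of L" for i using A by auto
  ultimately show "(\<lambda>i. \<mu> (A i)) sums \<mu> (\<Union>i. A i)" by (simp add: \<mu>)
qed

text \<open>
  The supremum is attained at \<open>B \<inter> H\<close>.
\<close>

lemma pos_variation_eq: assumes B: "B \<in> borel_sets_of L" shows "pos_variation L \<mu> B = measure P B"
  unfolding pos_variation_def
proof (rule cSup_eq_maximum)
  interpret sigma_algebra "topspace L" "borel_sets_of L" by (rule sigma_algebra_borel_sets_of)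
  have BH: "B \<inter> H \<in> borel_sets_of L" "B - H \<in> borel_sets_of L" using B H by auto
  have "measure N (B \<inter> H) \<le> measure N H" using H by (intro N.finite_measure_mono) (auto simp: sets_N)
  then have "measure N (B \<inter> H) = 0" using H(2) measure_nonneg[of N "B \<inter> H"] by linarith
  moreover have "measure P (B - H) \<le> measure P (topspace L - H)"
    using H B borel_sets_of_subset[OF B] by (intro P.finite_measure_mono) (auto simp: sets_P)
  then have "measure P (B - H) = 0" using H(3) measure_nonneg[of P "B - H"] by linarith
  then have "measure P B = measure P (B \<inter> H)"
    using P.finite_measure_Union[of "B \<inter> H" "B - H"] BH by (auto simp: sets_P Int_Diff Un_commute Un_Diff_Int)
  ultimately have "measure P B = \<mu> (B \<inter> H)" using \<mu>[OF BH(1)] by simp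
  then show "measure P B \<in> \<mu> ` {C \<in> borel_sets_of L. C \<subseteq> B}" using BH by (auto intro!: image_eqI)
  fix x assume "x \<in> \<mu> ` {C \<in> borel_sets_of L. C \<subseteq> B}"
  then obtain C where C: "C \<in> borel_sets_of L" "C \<subseteq> B" "x = \<mu> C" by auto
  have "x \<le> measure P C" using \<mu>[OF C(1)] C(3) by simp
  also have "\<dots> \<le> measure P B" using C B by (intro P.finite_measure_mono) (auto simp: sets_P)
  finally show "x \<le> measure P B" .
qed

lemma measure_of_pos_variation:
  "measure_of (topspace L) (borel_sets_of L) (\<lambda>B. ennreal (pos_variation L \<mu> B)) = P"
proof -
  interpret sigma_algebra "topspace L" "borel_sets_of L" by (rule sigma_algebra_borel_sets_of)
  have "measure_of (topspace L) (borel_sets_of L) (\<lambda>B. ennreal (pos_variation L \<mu> B)) =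
    measure_of (space P) (sets P) (emeasure P)"
    unfolding space_P sets_P
    by (rule measure_of_eq)
      (use space_closed in \<open>auto simp: sigma_sets_eq pos_variation_eq P.emeasure_eq_measure\<close>)
  then show ?thesis by (simp add: measure_of_of_measure)
qed

end

context hahn_pair begin

interpretation S: hahn_pair N P L "topspace L - H" "\<lambda>B. - \<mu> B" by (rule swap)

lemma neg_variation_eq: "B \<in> borel_sets_of L \<Longrightarrow> neg_variation L \<mu> B = measure N B"
  unfolding neg_variation_def by (rule S.pos_variation_eq)

lemma signed_integral_eq: "signed_integral L \<mu> f = (LINT x|P. f x) - (LINT x|N. f x)"
  using measure_of_pos_variation S.measure_of_pos_variation
  unfolding signed_integral_def neg_variation_def by simp

text \<open>
  This is what is extracted from weak* convergence: if \<open>B\<close> is clopen, its indicator is an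
  admissible test function.
\<close>

lemma signed_integral_indicator:
  assumes "B \<in> borel_sets_of L" shows "signed_integral L \<mu> (indicator B) = \<mu> B"
  using assms borel_sets_of_subset[OF assms] space_P S.space_P
  by (simp add: signed_integral_eq \<mu> sets_P sets_N Int_absorb2)

lemma radon_measureI:
  assumes cl: "\<And>K. compactin L K \<Longrightarrow> closedin L K"
    and reg: "\<And>B e. B \<in> borel_sets_of L \<Longrightarrow> 0 < e \<Longrightarrow>
      \<exists>K. compactin L K \<and> K \<subseteq> B \<and> measure P (B - K) < e"
      "\<And>B e. B \<in> borel_sets_of L \<Longrightarrow> 0 < e \<Longrightarrow>
      \<exists>K. compactin L K \<and> K \<subseteq> B \<and> measure N (B - K) < e"
  shows "radon_measure L \<mu>"
  unfolding radon_measure_def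
proof (intro conjI ballI allI impI signed_borel_measure)
  interpret sigma_algebra "topspace L" "borel_sets_of L" by (rule sigma_algebra_borel_sets_of)
  fix B and e :: real assume B: "B \<in> borel_sets_of L" and e: "0 < e"
  have bor: "K \<in> borel_sets_of L" if "compactin L K" for K
  proof -
    have "topspace L - (topspace L - K) \<in> borel_sets_of L"
      using cl[OF that] unfolding closedin_def borel_sets_of_def
      by (intro sigma_sets.Compl sigma_sets.Basic) simp
    then show ?thesis using compactin_subset_topspace[OF that] by (simp add: double_diff)
  qed
  obtain K1 where K1: "compactin L K1" "K1 \<subseteq> B" "measure P (B - K1) < e/2" using reg(1)[OF B, of "e/2"] e by auto
  obtain K2 where K2: "compactin L K2" "K2 \<subseteq> B" "measure N (B - K2) < e/2" using reg(2)[OF B, of "e/2"] e by auto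
  let ?K = "K1 \<union> K2"
  have K: "B - ?K \<in> borel_sets_of L" "B - K1 \<in> borel_sets_of L" "B - K2 \<in> borel_sets_of L"
    using B bor K1 K2 by auto
  have "measure P (B - ?K) \<le> measure P (B - K1)" "measure N (B - ?K) \<le> measure N (B - K2)"
    using K by (auto intro!: P.finite_measure_mono N.finite_measure_mono simp: sets_P sets_N)
  then have "total_variation L \<mu> (B - ?K) < e"
    using K1 K2 K by (simp add: total_variation_def pos_variation_eq neg_variation_eq)
  then show "\<exists>K. compactin L K \<and> K \<subseteq> B \<and> total_variation L \<mu> (B - K) < e"
    using K1 K2 by (intro exI[of _ ?K]) (auto intro: compactin_Un)
qed

end

section \<open>Absolutely summable functions and atomic measures\<close>

definition mass :: "('a \<Rightarrow> real) \<Rightarrow> 'a set \<Rightarrow> real" where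
  "mass f E = infsum (\<lambda>x. \<bar>f x\<bar>) E"

context
  fixes f :: "'a \<Rightarrow> real" and K :: "'a set"
  assumes f: "f summable_on K"
begin

lemma l1_summable: "E \<subseteq> K \<Longrightarrow> f summable_on E"
  using f by (rule summable_on_subset_banach)

lemma l1_abs_summable: "E \<subseteq> K \<Longrightarrow> (\<lambda>x. \<bar>f x\<bar>) summable_on E"
  using l1_summable[of E] summable_on_iff_abs_summable_on_real[of f E] by simp

lemma mass_nonneg: "0 \<le> mass f E"
  unfolding mass_def by (rule infsum_nonneg) simp

lemma mass_mono: "E \<subseteq> F \<Longrightarrow> F \<subseteq> K \<Longrightarrow> mass f E \<le> mass f F"
  unfolding mass_def by (rule infsum_mono2) (auto intro: l1_abs_summable)

lemma mass_Un_disjoint: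
  "E \<subseteq> K \<Longrightarrow> F \<subseteq> K \<Longrightarrow> E \<inter> F = {} \<Longrightarrow> mass f (E \<union> F) = mass f E + mass f F"
  unfolding mass_def by (rule infsum_Un_disjoint) (auto intro: l1_abs_summable)

lemma sum_Un_disjoint:
  "E \<subseteq> K \<Longrightarrow> F \<subseteq> K \<Longrightarrow> E \<inter> F = {} \<Longrightarrow> infsum f (E \<union> F) = infsum f E + infsum f F"
  by (rule infsum_Un_disjoint) (auto intro: l1_summable)

lemma mass_Un_le: "E \<subseteq> K \<Longrightarrow> F \<subseteq> K \<Longrightarrow> mass f (E \<union> F) \<le> mass f E + mass f F"
  using mass_Un_disjoint[of E "F - E"] mass_mono[of "F - E" F] subset_trans[OF Diff_subset, of F K E]
  by auto

lemma abs_infsum_le_mass: "E \<subseteq> K \<Longrightarrow> \<bar>infsum f E\<bar> \<le> mass f E"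
  unfolding mass_def using norm_infsum_bound[of f E] l1_abs_summable[of E] by simp

lemma mass_finite: "finite F \<Longrightarrow> mass f F = (\<Sum>x\<in>F. \<bar>f x\<bar>)"
  unfolding mass_def by simp

lemma mass_tail:
  assumes "E \<subseteq> K" "0 < d"
  obtains F where "finite F" "F \<subseteq> E" "mass f (E - F) \<le> d"
proof -
  obtain F where F: "finite F" "F \<subseteq> E" "dist (\<Sum>x\<in>F. \<bar>f x\<bar>) (mass f E) \<le> d"
    using infsum_finite_approximation[OF l1_abs_summable[OF assms(1)] assms(2)]
    unfolding mass_def by blast
  have "F \<union> (E - F) = E" using F by auto
  then have "mass f E = mass f F + mass f (E - F)"
    using mass_Un_disjoint[of F "E - F"] F assms by auto
  then show thesis using F that[of F] by (auto simp: mass_finite dist_real_def)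
qed

end

lemma
  fixes f g :: "'a \<Rightarrow> real"
  assumes f: "f summable_on E" and g: "g summable_on E"
  shows summable_on_diff: "(\<lambda>x. f x - g x) summable_on E"
    and infsum_diff: "infsum (\<lambda>x. f x - g x) E = infsum f E - infsum g E"
proof -
  have "((\<lambda>x. f x + - g x) has_sum (infsum f E + - infsum g E)) E"
    using f g by (intro has_sum_add) (auto simp: has_sum_uminus)
  then show "(\<lambda>x. f x - g x) summable_on E" "infsum (\<lambda>x. f x - g x) E = infsum f E - infsum g E"
    by (auto simp: summable_on_def infsumI)
qed

text \<open>
  Restricting the weighted counting measure to the Borel sets gives it the form required in \<open>hahn_pair\<close>.
\<close>

definition atomic :: "'a topology \<Rightarrow> ('a \<Rightarrow> real) \<Rightarrow> 'a measure" where
  "atomic L w = distr (density (count_space (topspace L)) (\<lambda>x. ennreal (w x)))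
     (measure_of (topspace L) (borel_sets_of L) (\<lambda>_. 0)) (\<lambda>x. x)"

lemma
  assumes w: "w summable_on topspace L" "\<And>x. 0 \<le> w x"
  shows sets_atomic: "sets (atomic L w) = borel_sets_of L"
    and measure_atomic: "B \<in> borel_sets_of L \<Longrightarrow> measure (atomic L w) B = infsum w B"
    and finite_atomic: "finite_measure (atomic L w)"
proof -
  interpret sigma_algebra "topspace L" "borel_sets_of L" by (rule sigma_algebra_borel_sets_of)
  let ?M = "measure_of (topspace L) (borel_sets_of L) (\<lambda>_. 0)"
  have sM: "sets ?M = borel_sets_of L" "space ?M = topspace L"
    using space_closed by (auto simp: sigma_sets_eq)
  show sets: "sets (atomic L w) = borel_sets_of L" by (simp add: atomic_def sM)
  have em: "emeasure (atomic L w) B = ennreal (infsum w B)" if B: "B \<in> borel_sets_of L" for B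
  proof -
    have Bs: "B \<subseteq> topspace L" using B borel_sets_of_subset by blast
    have "(\<lambda>x. norm (w x)) summable_on B"
      using summable_on_subset_banach[OF w(1) Bs] summable_on_iff_abs_summable_on_real[of w B] by blast
    then have abs: "Infinite_Set_Sum.abs_summable_on w B" using abs_summable_equivalent[of w B] by blast
    have "(\<lambda>x. x) \<in> measurable (density (count_space (topspace L)) (\<lambda>x. ennreal (w x))) ?M"
      by (auto simp: measurable_def sM)
    then have "emeasure (atomic L w) B = emeasure (density (count_space (topspace L)) (\<lambda>x. ennreal (w x))) B"
      unfolding atomic_def using B Bs by (subst emeasure_distr) (auto simp: sM Int_absorb2)
    also have "\<dots> = (\<integral>\<^sup>+x. ennreal (w x) * indicator B x \<partial>count_space (topspace L))"
      using Bs by (subst emeasure_density) auto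
    also have "\<dots> = (\<integral>\<^sup>+x. ennreal (w x) \<partial>count_space B)"
      using Bs by (auto simp: nn_integral_count_space_indicator intro!: nn_integral_cong split: split_indicator)
    also have "\<dots> = ennreal (infsetsum w B)"
      using abs w(2) by (intro nn_integral_conv_infsetsum) auto
    finally show ?thesis using infsetsum_infsum[OF abs] by simp
  qed
  then show "B \<in> borel_sets_of L \<Longrightarrow> measure (atomic L w) B = infsum w B"
    using w(2) by (simp add: measure_def infsum_nonneg)
  show "finite_measure (atomic L w)"
    by (rule finite_measureI) (use em[OF top] sets_eq_imp_space_eq in \<open>auto simp: atomic_def sM\<close>)
qed

lemma
  fixes f :: "'a \<Rightarrow> real"
  assumes f: "f summable_on K"
  shows summable_pos_part: "(\<lambda>x. max 0 (f x)) summable_on K"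
    and summable_neg_part: "(\<lambda>x. max 0 (- f x)) summable_on K"
proof -
  have half: "(\<lambda>x. (1/2) * (\<bar>f x\<bar> + s * f x)) summable_on K" for s
    by (intro summable_on_cmult_right summable_on_add l1_abs_summable[OF f] f order_refl)
  have "(\<lambda>x. max 0 (f x)) = (\<lambda>x. (1/2) * (\<bar>f x\<bar> + 1 * f x))"
    "(\<lambda>x. max 0 (- f x)) = (\<lambda>x. (1/2) * (\<bar>f x\<bar> + -1 * f x))" by auto
  then show "(\<lambda>x. max 0 (f x)) summable_on K" "(\<lambda>x. max 0 (- f x)) summable_on K"
    using half[of 1] half[of "-1"] by (simp_all only:)
qed

lemma infsum_indicator:
  fixes \<alpha> :: "'a \<Rightarrow> real"
  assumes "B \<subseteq> K" shows "infsum (\<lambda>x. \<alpha> x * indicator B x) K = infsum \<alpha> B"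
  using assms by (intro infsum_cong_neutral) (auto simp: indicator_def)

text \<open>
  Points are closed, so the countable set on which \<open>\<alpha>\<close> is positive is Borel and can serve as a Hahn set.
\<close>

lemma l1_hahn_pair:
  fixes L :: "'a topology" and \<alpha> :: "'a \<Rightarrow> real"
  assumes L: "Hausdorff_space L" and \<alpha>: "\<alpha> summable_on topspace L"
    and \<mu>: "\<And>B. B \<in> borel_sets_of L \<Longrightarrow> \<mu> B = infsum \<alpha> B"
  shows "hahn_pair (atomic L (\<lambda>x. max 0 (\<alpha> x))) (atomic L (\<lambda>x. max 0 (- \<alpha> x))) L
    {x \<in> topspace L. 0 < \<alpha> x} \<mu>"
proof -
  interpret sigma_algebra "topspace L" "borel_sets_of L" by (rule sigma_algebra_borel_sets_of)
  have abs: "(\<lambda>x. \<bar>\<alpha> x\<bar>) summable_on topspace L" using l1_abs_summable[OF \<alpha>, of "topspace L"] by simp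
  note p = summable_pos_part[OF \<alpha>] and n = summable_neg_part[OF \<alpha>]
  have single: "{x} \<in> borel_sets_of L" if "x \<in> topspace L" for x
  proof -
    have "closedin L {x}" using L that by (simp add: closedin_Hausdorff_singleton)
    then have "topspace L - {x} \<in> borel_sets_of L" by (auto simp: closedin_def borel_sets_of_def)
    then have "topspace L - (topspace L - {x}) \<in> borel_sets_of L" by (rule compl_sets)
    then show ?thesis using that by (simp add: double_diff)
  qed
  let ?H = "{x \<in> topspace L. 0 < \<alpha> x}"
  have "countable {x \<in> topspace L. \<alpha> x \<noteq> 0}" using abs by (intro abs_summable_countable) simp
  then have "countable ?H" by (rule countable_subset[rotated]) auto
  then have "(\<Union>x\<in>?H. {x}) \<in> borel_sets_of L" using single by (intro countable_UN'') auto
  then have H: "?H \<in> borel_sets_of L" by simp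
  show ?thesis
  proof (intro hahn_pair.intro hahn_pair_axioms.intro)
    show "finite_measure (atomic L (\<lambda>x. max 0 (\<alpha> x)))" "finite_measure (atomic L (\<lambda>x. max 0 (- \<alpha> x)))"
      using p n by (auto intro: finite_atomic)
    show "sets (atomic L (\<lambda>x. max 0 (\<alpha> x))) = borel_sets_of L"
      "sets (atomic L (\<lambda>x. max 0 (- \<alpha> x))) = borel_sets_of L"
      by (rule sets_atomic[OF p], simp) (rule sets_atomic[OF n], simp)
    show "?H \<in> borel_sets_of L" by (rule H)
    have "infsum (\<lambda>x. max 0 (- \<alpha> x)) ?H = infsum (\<lambda>x. 0) ?H" by (intro infsum_cong) auto
    then show "measure (atomic L (\<lambda>x. max 0 (- \<alpha> x))) ?H = 0" using measure_atomic[OF n _ H] by simp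
    have "infsum (\<lambda>x. max 0 (\<alpha> x)) (topspace L - ?H) = infsum (\<lambda>x. 0) (topspace L - ?H)"
      by (intro infsum_cong) auto
    then show "measure (atomic L (\<lambda>x. max 0 (\<alpha> x))) (topspace L - ?H) = 0"
      using measure_atomic[OF p _ compl_sets[OF H]] by simp
    fix B assume B: "B \<in> borel_sets_of L"
    then have "B \<subseteq> topspace L" by (rule borel_sets_of_subset)
    then have "infsum (\<lambda>x. max 0 (\<alpha> x) - max 0 (- \<alpha> x)) B =
        infsum (\<lambda>x. max 0 (\<alpha> x)) B - infsum (\<lambda>x. max 0 (- \<alpha> x)) B"
      using p n by (intro infsum_diff) (auto intro: summable_on_subset_banach)
    moreover have "(\<lambda>x. max 0 (\<alpha> x) - max 0 (- \<alpha> x)) = \<alpha>" by auto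
    ultimately have "infsum \<alpha> B = infsum (\<lambda>x. max 0 (\<alpha> x)) B - infsum (\<lambda>x. max 0 (- \<alpha> x)) B" by simp
    then show "\<mu> B = measure (atomic L (\<lambda>x. max 0 (\<alpha> x))) B - measure (atomic L (\<lambda>x. max 0 (- \<alpha> x))) B"
      using measure_atomic[OF p _ B] measure_atomic[OF n _ B] \<mu>[OF B] by simp
  qed
qed

text \<open>
  Finite sets are compact and carry all but an arbitrarily small part of an atomic measure.
\<close>

lemma atomic_inner_regular:
  assumes L: "Hausdorff_space L" and w: "w summable_on topspace L" "\<And>x. 0 \<le> w x"
    and B: "B \<in> borel_sets_of L" and e: "0 < e"
  shows "\<exists>K. compactin L K \<and> K \<subseteq> B \<and> measure (atomic L w) (B - K) < e"
proof -
  interpret sigma_algebra "topspace L" "borel_sets_of L" by (rule sigma_algebra_borel_sets_of)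
  have Bs: "B \<subseteq> topspace L" using B by (rule borel_sets_of_subset)
  obtain F where F: "finite F" "F \<subseteq> B" "mass w (B - F) \<le> e/2"
    using mass_tail[OF w(1) Bs, of "e/2"] e by auto
  have "closedin L F" using F Bs L by (intro closedin_Hausdorff_finite) auto
  then have "topspace L - F \<in> borel_sets_of L" by (auto simp: closedin_def borel_sets_of_def)
  then have "B \<inter> (topspace L - F) \<in> borel_sets_of L" using B by (rule Int[rotated])
  moreover have "B \<inter> (topspace L - F) = B - F" using Bs by auto
  ultimately have "measure (atomic L w) (B - F) = infsum w (B - F)" using measure_atomic[OF w] by simp
  also have "\<dots> = mass w (B - F)" unfolding mass_def using w(2) by simp
  finally have "measure (atomic L w) (B - F) < e" using F e by simp
  moreover have "compactin L F" using F Bs by (intro finite_imp_compactin) auto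
  ultimately show ?thesis using F by blast
qed

lemma l1_radon_measure:
  fixes L :: "'a topology" and \<alpha> :: "'a \<Rightarrow> real"
  assumes L: "Hausdorff_space L" and \<alpha>: "\<alpha> summable_on topspace L"
    and \<mu>: "\<And>B. B \<in> borel_sets_of L \<Longrightarrow> \<mu> B = infsum \<alpha> B"
  shows "radon_measure L \<mu>"
proof -
  interpret hahn_pair "atomic L (\<lambda>x. max 0 (\<alpha> x))" "atomic L (\<lambda>x. max 0 (- \<alpha> x))" L
    "{x \<in> topspace L. 0 < \<alpha> x}" \<mu>
    using assms by (rule l1_hahn_pair)
  show ?thesis
    by (rule radon_measureI)
      (use L summable_pos_part[OF \<alpha>] summable_neg_part[OF \<alpha>] in \<open>auto intro: compactin_imp_closedin atomic_inner_regular\<close>)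
qed

lemma zero_radon_measure: "Hausdorff_space L \<Longrightarrow> radon_measure L (\<lambda>B. 0)"
  by (rule l1_radon_measure[where \<alpha> = "\<lambda>x. 0"]) auto

lemma signed_integral_zero:
  assumes "Hausdorff_space L" shows "signed_integral L (\<lambda>B. 0) f = 0"
proof -
  have "hahn_pair (atomic L (\<lambda>x. max 0 0)) (atomic L (\<lambda>x. max 0 (- 0))) L
    {x \<in> topspace L. (0::real) < 0} (\<lambda>B. 0)"
    using assms by (intro l1_hahn_pair) auto
  then show ?thesis using hahn_pair.signed_integral_eq by fastforce
qed

section \<open>The Stone space of an algebra of sets\<close>

locale set_algebra = algebra UNIV A for A :: "'x set set"
begin

definition points :: "'x set set set" where
  "points = {p. p \<subseteq> A \<and> UNIV \<in> p \<and> {} \<notin> p \<and> (\<forall>a\<in>p. \<forall>b\<in>p. a \<inter> b \<in> p) \<and>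
     (\<forall>a\<in>p. \<forall>b\<in>A. a \<subseteq> b \<longrightarrow> b \<in> p) \<and> (\<forall>a\<in>A. a \<in> p \<or> - a \<in> p)}"

definition clop :: "'x set \<Rightarrow> 'x set set set" where
  "clop a = {p \<in> points. a \<in> p}"

definition stone :: "'x set set topology" where
  "stone = topology (\<lambda>U. U \<subseteq> points \<and> (\<forall>p\<in>U. \<exists>a\<in>A. p \<in> clop a \<and> clop a \<subseteq> U))"

lemma Compl_in: "a \<in> A \<Longrightarrow> - a \<in> A"
  using compl_sets[of a] by (simp add: Compl_eq_Diff_UNIV)

lemma pointsD:
  assumes "p \<in> points"
  shows "p \<subseteq> A" "{} \<notin> p" "a \<in> p \<Longrightarrow> b \<in> p \<Longrightarrow> a \<inter> b \<in> p"
    "a \<in> p \<Longrightarrow> b \<in> A \<Longrightarrow> a \<subseteq> b \<Longrightarrow> b \<in> p" "a \<in> A \<Longrightarrow> a \<in> p \<or> - a \<in> p"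
  using assms by (simp_all add: points_def)

lemma clop_subset: "clop a \<subseteq> points"
  by (auto simp: clop_def)

lemma clop_UNIV: "clop UNIV = points" and clop_empty: "clop {} = {}"
  by (auto simp: clop_def points_def)

lemma clop_Int: "a \<in> A \<Longrightarrow> b \<in> A \<Longrightarrow> clop (a \<inter> b) = clop a \<inter> clop b"
proof -
  assume A: "a \<in> A" "b \<in> A"
  have "a \<inter> b \<in> p \<longleftrightarrow> a \<in> p \<and> b \<in> p" if "p \<in> points" for p
    using pointsD(3)[OF that, of a b] pointsD(4)[OF that, of "a \<inter> b" a]
      pointsD(4)[OF that, of "a \<inter> b" b] A by blast
  then show ?thesis by (auto simp: clop_def)
qed

lemma clop_Compl: assumes "a \<in> A" shows "clop (- a) = points - clop a"
proof -
  have "p \<in> points \<Longrightarrow> a \<in> p \<Longrightarrow> - a \<notin> p" for p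
    using pointsD(2)[of p] pointsD(3)[of p a "- a"] by auto
  moreover have "p \<in> points \<Longrightarrow> a \<notin> p \<Longrightarrow> - a \<in> p" for p
    using assms pointsD(5) by blast
  ultimately show ?thesis unfolding clop_def by blast
qed

lemma clop_Un: assumes "a \<in> A" "b \<in> A" shows "clop (a \<union> b) = clop a \<union> clop b"
proof -
  have "clop (a \<union> b) = clop (- (- a \<inter> - b))" by simp
  also have "\<dots> = clop a \<union> clop b"
  proof -
    have "- a \<inter> - b \<in> A" using assms by (intro Int Compl_in)
    then have "clop (- (- a \<inter> - b)) = points - clop (- a \<inter> - b)" by (rule clop_Compl)
    also have "\<dots> = points - (points - clop a) \<inter> (points - clop b)"
      using assms by (simp only: clop_Int clop_Compl Compl_in)
    finally show ?thesis using clop_subset[of a] clop_subset[of b] by blast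
  qed
  finally show ?thesis .
qed

lemma clop_finite_UN:
  "finite I \<Longrightarrow> (\<And>i. i \<in> I \<Longrightarrow> f i \<in> A) \<Longrightarrow> clop (\<Union>i\<in>I. f i) = (\<Union>i\<in>I. clop (f i))"
proof (induction I rule: finite_induct)
  case (insert i I)
  then have "clop (f i \<union> (\<Union>i\<in>I. f i)) = clop (f i) \<union> clop (\<Union>i\<in>I. f i)"
    by (intro clop_Un finite_UN) auto
  with insert show ?case by simp
qed (simp add: clop_empty)

lemma principal_point: "{a \<in> A. x \<in> a} \<in> points"
  unfolding points_def by (auto intro: Compl_in)

lemma clop_subset_iff:
  assumes "a \<in> A" "b \<in> A" shows "clop a \<subseteq> clop b \<longleftrightarrow> a \<subseteq> b"
proof
  assume *: "clop a \<subseteq> clop b"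
  show "a \<subseteq> b"
  proof
    fix x assume "x \<in> a"
    then have "{c \<in> A. x \<in> c} \<in> clop a" using principal_point assms by (simp add: clop_def)
    with * show "x \<in> b" by (auto simp: clop_def)
  qed
next
  assume "a \<subseteq> b"
  then show "clop a \<subseteq> clop b" using assms pointsD(4) by (auto simp: clop_def)
qed

lemma openin_stone:
  "openin stone U \<longleftrightarrow> U \<subseteq> points \<and> (\<forall>p\<in>U. \<exists>a\<in>A. p \<in> clop a \<and> clop a \<subseteq> U)"
proof -
  define opn where "opn U \<longleftrightarrow> U \<subseteq> points \<and> (\<forall>p\<in>U. \<exists>a\<in>A. p \<in> clop a \<and> clop a \<subseteq> U)" for U
  have "opn (S \<inter> T)" if S: "opn S" and T: "opn T" for S T
    unfolding opn_def
  proof (intro conjI ballI)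
    show "S \<inter> T \<subseteq> points" using S by (auto simp: opn_def)
    fix p assume p: "p \<in> S \<inter> T"
    obtain a where a: "a \<in> A" "p \<in> clop a" "clop a \<subseteq> S" using S p by (auto simp: opn_def)
    obtain b where b: "b \<in> A" "p \<in> clop b" "clop b \<subseteq> T" using T p by (auto simp: opn_def)
    show "\<exists>a\<in>A. p \<in> clop a \<and> clop a \<subseteq> S \<inter> T"
      using a b by (intro bexI[of _ "a \<inter> b"]) (auto simp: clop_Int)
  qed
  moreover have "opn (\<Union>\<K>)" if "\<forall>K\<in>\<K>. opn K" for \<K>
    unfolding opn_def
  proof (intro conjI ballI)
    show "\<Union>\<K> \<subseteq> points" using that by (auto simp: opn_def)
    fix p assume "p \<in> \<Union>\<K>"
    then obtain K where K: "K \<in> \<K>" "p \<in> K" by blast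
    then have "opn K" using that by simp
    then obtain a where "a \<in> A" "p \<in> clop a" "clop a \<subseteq> K" using K(2) by (auto simp: opn_def)
    with K show "\<exists>a\<in>A. p \<in> clop a \<and> clop a \<subseteq> \<Union>\<K>" by blast
  qed
  ultimately have "istopology opn" unfolding istopology_def by blast
  then have "istopology (\<lambda>U. U \<subseteq> points \<and> (\<forall>p\<in>U. \<exists>a\<in>A. p \<in> clop a \<and> clop a \<subseteq> U))"
    by (simp add: opn_def[abs_def])
  then show ?thesis unfolding stone_def by (simp add: topology_inverse')
qed

lemma openin_stoneE:
  assumes "openin stone U" "p \<in> U"
  obtains a where "a \<in> A" "p \<in> clop a" "clop a \<subseteq> U"
  using assms by (auto simp: openin_stone)

lemma topspace_stone: "topspace stone = points"
proof -
  have "openin stone points"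
    unfolding openin_stone using clop_UNIV by blast
  then show ?thesis
    by (metis openin_stone openin_subset openin_topspace subset_antisym)
qed

lemma openin_clop: "a \<in> A \<Longrightarrow> openin stone (clop a)"
  unfolding openin_stone using clop_subset by blast

lemma closedin_clop: "a \<in> A \<Longrightarrow> closedin stone (clop a)"
  using openin_clop[of "- a"] clop_subset
  by (simp add: closedin_def topspace_stone clop_Compl Compl_in)

lemma separate_points:
  assumes "p \<in> points" "q \<in> points" "p \<noteq> q"
  obtains a where "a \<in> A" "p \<in> clop a" "q \<notin> clop a"
proof -
  have "\<exists>a\<in>A. a \<in> p \<and> a \<notin> q"
  proof (rule ccontr)
    assume "\<not> ?thesis"
    then have pq: "p \<subseteq> q" using pointsD(1)[OF assms(1)] by blast
    have "q \<subseteq> p"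
    proof
      fix a assume a: "a \<in> q"
      then have "a \<in> A" using pointsD(1)[OF assms(2)] by blast
      show "a \<in> p"
      proof (rule ccontr)
        assume "a \<notin> p"
        then have "- a \<in> q" using pq \<open>a \<in> A\<close> pointsD(5)[OF assms(1)] by blast
        with a have "a \<inter> - a \<in> q" by (rule pointsD(3)[OF assms(2)])
        then show False using pointsD(2)[OF assms(2)] by simp
      qed
    qed
    with pq assms show False by blast
  qed
  then show thesis using that assms by (auto simp: clop_def)
qed

lemma Hausdorff_stone: "Hausdorff_space stone"
  unfolding Hausdorff_space_def
proof (intro allI impI, elim conjE)
  fix p q assume "p \<in> topspace stone" "q \<in> topspace stone" "p \<noteq> q"
  then obtain a where a: "a \<in> A" "p \<in> clop a" "q \<notin> clop a"
    using separate_points by (metis topspace_stone)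
  then show "\<exists>U V. openin stone U \<and> openin stone V \<and> p \<in> U \<and> q \<in> V \<and> disjnt U V"
  proof (intro exI conjI)
    show "openin stone (clop a)" "openin stone (clop (- a))"
      using a by (auto intro: openin_clop Compl_in)
    show "q \<in> clop (- a)" "disjnt (clop a) (clop (- a))"
      using a \<open>q \<in> topspace stone\<close> by (auto simp: clop_Compl topspace_stone disjnt_def)
  qed (rule a(2))
qed

text \<open>
  If no finitely many of the sets \<open>a\<close> whose clopen set lies in some member of the cover have
  union \<open>UNIV\<close>, then the complements of these sets generate a proper filter. An ultrafilter that
  refines it defines a point that no member of the cover contains.
\<close>

lemma compact_stone: "compact_space stone"
  unfolding compact_space_alt
proof (intro allI impI)
  fix \<U> assume "(\<forall>U\<in>\<U>. openin stone U) \<and> topspace stone \<subseteq> \<Union>\<U>"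
  then have op: "\<And>U. U \<in> \<U> \<Longrightarrow> openin stone U" and cov: "points \<subseteq> \<Union>\<U>"
    by (auto simp: topspace_stone)
  define C where "C = {a \<in> A. \<exists>U\<in>\<U>. clop a \<subseteq> U}"
  have "\<exists>D\<subseteq>C. finite D \<and> \<Union>D = UNIV"
  proof (rule ccontr)
    assume no: "\<not> (\<exists>D\<subseteq>C. finite D \<and> \<Union>D = UNIV)"
    define F where "F = (INF a\<in>C. principal (- a))"
    have "F \<noteq> bot"
    proof
      assume "F = bot"
      then have "eventually (\<lambda>_. False) F" by simp
      then obtain D where D: "D \<subseteq> C" "finite D" "eventually (\<lambda>_. False) (INF a\<in>D. principal (- a))"
        unfolding F_def using eventually_INF[of "\<lambda>_. False" "\<lambda>a. principal (- a)" C] by blast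
      then have "\<forall>x. \<exists>a\<in>D. x \<in> a"
        by (simp add: INF_principal_finite eventually_principal)
      then have "\<Union>D = UNIV" by blast
      with no D show False by blast
    qed
    then obtain G where G: "ultra G" "G \<le> F" by (rule ultra_refines)
    define p where "p = {a \<in> A. eventually (\<lambda>x. x \<in> a) G}"
    have "p \<in> points"
      unfolding points_def
    proof (intro CollectI conjI ballI impI)
      show "{} \<notin> p" using G(1) by (simp add: p_def ultra_def trivial_limit_def)
    next
      fix a b assume "a \<in> p" "b \<in> p"
      then show "a \<inter> b \<in> p" by (simp add: p_def eventually_conj Int)
    next
      fix a b assume "a \<in> p" "b \<in> A" "a \<subseteq> b"
      then show "b \<in> p" using eventually_mono[of "\<lambda>x. x \<in> a" G "\<lambda>x. x \<in> b"] by (auto simp: p_def)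
    next
      fix a assume "a \<in> A"
      then show "a \<in> p \<or> - a \<in> p" using G(1) by (auto simp: p_def ultra_def Compl_in)
    qed (auto simp: p_def)
    then obtain U where "U \<in> \<U>" "p \<in> U" using cov by blast
    obtain a where a: "a \<in> A" "p \<in> clop a" "clop a \<subseteq> U"
      using op[OF \<open>U \<in> \<U>\<close>] \<open>p \<in> U\<close> by (rule openin_stoneE)
    then have "a \<in> C" using \<open>U \<in> \<U>\<close> unfolding C_def by blast
    then have "F \<le> principal (- a)" unfolding F_def by (rule INF_lower)
    then have "eventually (\<lambda>x. x \<in> - a) G"
      using filter_leD[OF G(2)] by (simp add: le_principal)
    moreover have "eventually (\<lambda>x. x \<in> a) G" using a(2) by (simp add: clop_def p_def)
    ultimately have "eventually (\<lambda>_. False) G" by eventually_elim auto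
    then show False using G(1) by (simp add: ultra_def trivial_limit_def)
  qed
  then obtain D where D: "D \<subseteq> C" "finite D" "\<Union>D = UNIV" by blast
  then have "\<forall>a\<in>D. \<exists>U. U \<in> \<U> \<and> clop a \<subseteq> U" by (auto simp: C_def)
  then obtain h where h: "\<And>a. a \<in> D \<Longrightarrow> h a \<in> \<U> \<and> clop a \<subseteq> h a"
    using bchoice[of D "\<lambda>a U. U \<in> \<U> \<and> clop a \<subseteq> U"] by blast
  have "points = (\<Union>a\<in>D. clop a)"
    using clop_finite_UN[of D "\<lambda>a. a"] D clop_UNIV by (auto simp: C_def)
  then have "points \<subseteq> \<Union>(h ` D)" using h by blast
  then show "\<exists>\<F>. finite \<F> \<and> \<F> \<subseteq> \<U> \<and> topspace stone \<subseteq> \<Union>\<F>"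
    using D h by (intro exI[of _ "h ` D"]) (auto simp: topspace_stone)
qed

lemma compactin_clop: "a \<in> A \<Longrightarrow> compactin stone (clop a)"
  using closedin_compact_space[OF compact_stone closedin_clop] .

text \<open>
  The principal ultrafilters are dense, as every nonempty \<open>a\<close> has an element.
\<close>

lemma separable_stone:
  assumes "countable (UNIV :: 'x set)"
  shows "separable_space stone"
  unfolding separable_space_def
proof (intro exI conjI)
  let ?C = "range (\<lambda>x. {a \<in> A. x \<in> a})"
  show "countable ?C" using assms by simp
  show "?C \<subseteq> topspace stone" by (auto simp: topspace_stone principal_point)
  show "stone closure_of ?C = topspace stone"
  proof (intro subset_antisym closure_of_subset_topspace subsetI)
    fix p assume p: "p \<in> topspace stone"
    have "\<exists>y\<in>?C. y \<in> U" if pU: "p \<in> U" and oU: "openin stone U" for U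
    proof -
      obtain a where a: "a \<in> A" "p \<in> clop a" "clop a \<subseteq> U"
        using openin_stoneE[OF oU pU] by blast
      then obtain x where "x \<in> a" using clop_empty by fastforce
      then have "{a \<in> A. x \<in> a} \<in> clop a" using principal_point a by (auto simp: clop_def)
      then show ?thesis using a by blast
    qed
    then show "p \<in> stone closure_of ?C" using p by (auto simp: in_closure_of)
  qed
qed

lemma clop_borel: "a \<in> A \<Longrightarrow> clop a \<in> borel_sets_of stone"
  unfolding borel_sets_of_def by (intro sigma_sets.Basic) (simp add: openin_clop)

lemma algebra_clop: "algebra points (clop ` A)"
  unfolding algebra_iff_Un
proof (intro conjI ballI)
  show "clop ` A \<subseteq> Pow points" using clop_subset by auto
  show "{} \<in> clop ` A" using clop_empty by (metis empty_sets image_eqI)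
  fix c assume "c \<in> clop ` A"
  then obtain a where a: "a \<in> A" "c = clop a" by auto
  then show "points - c \<in> clop ` A" by (simp flip: clop_Compl add: Compl_in)
  fix d assume "d \<in> clop ` A"
  then obtain b where b: "b \<in> A" "d = clop b" by auto
  then have "c \<union> d = clop (a \<union> b)" using a by (simp add: clop_Un)
  then show "c \<union> d \<in> clop ` A" using a b by auto
qed

text \<open>
  An open cover of a clopen set splits the underlying set of the algebra accordingly. For a finitely additive
  function on \<open>A\<close> this replaces countable subadditivity.
\<close>

lemma compact_clop_cover:
  assumes a: "a \<in> A" and op: "\<And>i. openin stone (U i)" and cov: "clop a \<subseteq> (\<Union>i. U i)"
  obtains I c where "finite I" "\<And>i. i \<in> I \<Longrightarrow> c i \<in> A" "\<And>i. i \<in> I \<Longrightarrow> clop (c i) \<subseteq> U i"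
    "a = (\<Union>i\<in>I. c i)"
proof -
  define \<B> where "\<B> = clop ` {b \<in> A. b \<subseteq> a \<and> (\<exists>i. clop b \<subseteq> U i)}"
  have "clop a \<subseteq> \<Union>\<B>"
  proof
    fix p assume p: "p \<in> clop a"
    then obtain i where "p \<in> U i" using cov by blast
    then obtain b where b: "b \<in> A" "p \<in> clop b" "clop b \<subseteq> U i"
      using op[of i] by (auto elim: openin_stoneE)
    have "clop (b \<inter> a) \<in> \<B>" using a b clop_Int unfolding \<B>_def by blast
    then show "p \<in> \<Union>\<B>" using p b a by (auto simp: clop_Int)
  qed
  moreover have "\<And>B. B \<in> \<B> \<Longrightarrow> openin stone B" by (auto simp: \<B>_def openin_clop)
  ultimately obtain \<F> where \<F>: "finite \<F>" "\<F> \<subseteq> \<B>" "clop a \<subseteq> \<Union>\<F>"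
    using compactin_clop[OF a] unfolding compactin_def by meson
  have "\<exists>D. finite D \<and> D \<subseteq> {b \<in> A. b \<subseteq> a \<and> (\<exists>i. clop b \<subseteq> U i)} \<and> \<F> = clop ` D"
  proof -
    from finite_subset_image[OF \<F>(1) \<F>(2)[unfolded \<B>_def]] show ?thesis by auto
  qed
  then obtain D where D: "finite D" "D \<subseteq> {b \<in> A. b \<subseteq> a \<and> (\<exists>i. clop b \<subseteq> U i)}" "\<F> = clop ` D"
    by blast
  then have "\<forall>b\<in>D. \<exists>i. clop b \<subseteq> U i" by blast
  then obtain h where h: "\<And>b. b \<in> D \<Longrightarrow> clop b \<subseteq> U (h b)"
    using bchoice[of D "\<lambda>b i. clop b \<subseteq> U i"] by blast
  define c where "c i = \<Union>{b \<in> D. h b = i}" for i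
  have cl: "clop (\<Union>E) = (\<Union>b\<in>E. clop b)" if "E \<subseteq> D" for E
    using clop_finite_UN[of E "\<lambda>b. b"] that D by (auto intro: finite_subset)
  have inA: "\<Union>E \<in> A" if "E \<subseteq> D" for E
    using that D by (intro finite_Union) (auto intro: finite_subset)
  show thesis
  proof
    show "finite (h ` D)" using D by simp
    show "c i \<in> A" for i unfolding c_def by (intro inA) auto
    show "clop (c i) \<subseteq> U i" for i unfolding c_def using h by (subst cl) auto
    have "clop a \<subseteq> clop (\<Union>D)" using \<F>(3) D(3) cl[of D] by simp
    then have "a \<subseteq> \<Union>D" using clop_subset_iff a inA by blast
    moreover have "\<Union>D \<subseteq> a" using D by blast
    ultimately show "a = (\<Union>i\<in>h ` D. c i)" by (auto simp: c_def)
  qed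
qed

lemma continuous_indicator_clop:
  assumes "a \<in> A" shows "continuous_map stone euclideanreal (indicator (clop a))"
  unfolding continuous_map_def
proof (intro conjI allI impI)
  fix U :: "real set" assume "openin euclideanreal U"
  have "{p \<in> topspace stone. indicator (clop a) p \<in> U} =
    (if 1 \<in> U then clop a else {}) \<union> (if 0 \<in> U then clop (- a) else {})"
    using assms clop_subset by (auto simp: topspace_stone clop_Compl indicator_def split: if_splits)
  then show "openin stone {p \<in> topspace stone. indicator (clop a) p \<in> U}"
    using assms by (auto intro!: openin_Un openin_clop Compl_in)
qed auto

text \<open>
  Simple functions over clopen sets are uniformly dense in the continuous functions. Each
  value \<open>v\<close> also serves as the index of the clopen set on which the approximation takes it; the linear order of
  the values makes the finite cover disjoint.
\<close>

lemma clop_step_approximation: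
  fixes f :: "'x set set \<Rightarrow> real"
  assumes f: "continuous_map stone euclideanreal f" and e: "0 < e"
  obtains I c where "finite I" "\<And>v. v \<in> I \<Longrightarrow> c v \<in> A"
    "\<And>p. p \<in> points \<Longrightarrow> \<bar>f p - (\<Sum>v\<in>I. v * indicator (clop (c v)) p)\<bar> < e"
proof -
  define U where "U v = {p \<in> points. f p \<in> ball v e}" for v
  have op: "openin stone (U v)" for v
    unfolding U_def topspace_stone[symmetric]
    by (rule openin_continuous_map_preimage[OF f]) simp
  have cov: "clop UNIV \<subseteq> (\<Union>v. U v)"
  proof
    fix p assume "p \<in> clop UNIV"
    then have "p \<in> U (f p)" using e by (simp add: clop_UNIV U_def)
    then show "p \<in> (\<Union>v. U v)" by blast
  qed
  obtain I c where I: "finite I" "\<And>v. v \<in> I \<Longrightarrow> c v \<in> A" "\<And>v. v \<in> I \<Longrightarrow> clop (c v) \<subseteq> U v"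
    "UNIV = (\<Union>v\<in>I. c v)"
    by (rule compact_clop_cover[OF top op cov]) blast
  define d where "d v = c v - (\<Union>u\<in>{u \<in> I. u < v}. c u)" for v
  have dA: "d v \<in> A" if "v \<in> I" for v
    unfolding d_def using I that by (intro Diff finite_UN) auto
  have ddis: "clop (d u) \<inter> clop (d v) = {}" if "u \<in> I" "v \<in> I" "u \<noteq> v" for u v
  proof -
    have "d u \<inter> d v = {}" using that by (auto simp: d_def neq_iff)
    then show ?thesis using clop_Int[of "d u" "d v"] dA that clop_empty by simp
  qed
  have dcov: "UNIV = (\<Union>v\<in>I. d v)"
  proof (intro subset_antisym subsetI)
    fix x
    let ?J = "{v \<in> I. x \<in> c v}"
    have J: "finite ?J" "?J \<noteq> {}" using I by auto
    have "x \<in> d (Min ?J)"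
      using Min_in[OF J] Min_le[OF J(1)] by (fastforce simp: d_def)
    then show "x \<in> (\<Union>v\<in>I. d v)" using Min_in[OF J] by auto
  qed auto
  have "\<bar>f p - (\<Sum>v\<in>I. v * indicator (clop (d v)) p)\<bar> < e" if p: "p \<in> points" for p
  proof -
    have "points = (\<Union>v\<in>I. clop (d v))"
      using clop_finite_UN[OF I(1), of d] dA dcov clop_UNIV by simp
    then obtain u where u: "u \<in> I" "p \<in> clop (d u)" using p by blast
    have "(\<Sum>v\<in>I. v * indicator (clop (d v)) p) = (\<Sum>v\<in>I. if v = u then u else 0)"
      using u ddis[OF _ u(1)] by (intro sum.cong) (auto simp: indicator_def)
    also have "\<dots> = u" using u I by simp
    finally have "(\<Sum>v\<in>I. v * indicator (clop (d v)) p) = u" .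
    moreover have "p \<in> clop (c u)"
      using u clop_subset_iff[of "d u" "c u"] dA I by (auto simp: d_def)
    then have "p \<in> U u" using I u by blast
    then have "\<bar>f p - u\<bar> < e" by (simp add: U_def dist_real_def abs_minus_commute)
    ultimately show ?thesis by simp
  qed
  with I(1) dA show thesis by (rule that)
qed

lemma integral_clop_step:
  fixes f :: "'x set set \<Rightarrow> real"
  assumes P: "finite_measure P" "sets P = borel_sets_of stone" "space P = points"
    and f: "continuous_map stone euclideanreal f"
    and I: "finite I" "\<And>v. v \<in> I \<Longrightarrow> c v \<in> A"
    and approx: "\<And>p. p \<in> points \<Longrightarrow> \<bar>f p - (\<Sum>v\<in>I. v * indicator (clop (c v)) p)\<bar> < e"
  shows "\<bar>(LINT p|P. f p) - (\<Sum>v\<in>I. v * measure P (clop (c v)))\<bar> \<le> e * measure P points"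
proof -
  interpret finite_measure P by (rule P)
  define g where "g p = (\<Sum>v\<in>I. v * indicator (clop (c v)) p)" for p
  have cs: "clop (c v) \<in> sets P" if "v \<in> I" for v using that I P by (simp add: clop_borel)
  have gi: "integrable P g"
    unfolding g_def using cs
    by (intro Bochner_Integration.integrable_sum integrable_mult_right integrable_real_indicator)
      (auto simp: emeasure_eq_measure)
  have fm: "f \<in> borel_measurable P"
  proof (rule borel_measurableI)
    fix S :: "real set" assume "open S"
    then have "openin stone {p \<in> topspace stone. f p \<in> S}"
      by (intro openin_continuous_map_preimage[OF f]) simp
    moreover have "{p \<in> topspace stone. f p \<in> S} = f -` S \<inter> space P"
      by (auto simp: P(3) topspace_stone)
    ultimately show "f -` S \<inter> space P \<in> sets P" by (auto simp: P(2) borel_sets_of_def)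
  qed
  have fg: "integrable P (\<lambda>p. f p - g p)"
  proof (rule integrable_const_bound[where B = e])
    show "AE p in P. norm (f p - g p) \<le> e"
      using approx by (auto simp: g_def P(3) intro!: AE_I2 less_imp_le)
    show "(\<lambda>p. f p - g p) \<in> borel_measurable P"
      using fm borel_measurable_integrable[OF gi] by (rule borel_measurable_diff)
  qed
  have "(LINT p|P. g p) = (\<Sum>v\<in>I. v * measure P (clop (c v)))"
    unfolding g_def using cs
    by (subst Bochner_Integration.integral_sum) (auto simp: emeasure_eq_measure Int_absorb2 P(3) clop_subset)
  moreover have "(LINT p|P. f p - g p) + (LINT p|P. g p) = (LINT p|P. f p)"
    using Bochner_Integration.integral_add[OF fg gi] by simp
  moreover have "\<bar>LINT p|P. f p - g p\<bar> \<le> (LINT p|P. e)"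
  proof -
    have "\<bar>LINT p|P. f p - g p\<bar> \<le> (LINT p|P. \<bar>f p - g p\<bar>)" by (rule integral_abs_bound)
    also have "\<dots> \<le> (LINT p|P. e)"
      using fg approx by (intro integral_mono) (auto simp: g_def P(3) intro: less_imp_le)
    finally show ?thesis .
  qed
  moreover have "(LINT p|P. e) = e * measure P points" by (simp add: P(3))
  ultimately show ?thesis by linarith
qed

end

section \<open>Extension of finitely additive measures to the Stone space\<close>

locale content_on_algebra = set_algebra A for A :: "'x set set" +
  fixes \<kappa> :: "'x set \<Rightarrow> real"
  assumes nonneg: "a \<in> A \<Longrightarrow> 0 \<le> \<kappa> a"
    and add: "a \<in> A \<Longrightarrow> b \<in> A \<Longrightarrow> a \<inter> b = {} \<Longrightarrow> \<kappa> (a \<union> b) = \<kappa> a + \<kappa> b"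
begin

lemma empty: "\<kappa> {} = 0"
  using add[of "{}" "{}"] by simp

lemma mono: assumes "a \<in> A" "b \<in> A" "a \<subseteq> b" shows "\<kappa> a \<le> \<kappa> b"
proof -
  have "b = a \<union> (b - a)" using assms by auto
  then have "\<kappa> b = \<kappa> a + \<kappa> (b - a)" using assms add[of a "b - a"] by auto
  then show ?thesis using nonneg[of "b - a"] assms by auto
qed

lemma subadd: assumes "a \<in> A" "b \<in> A" shows "\<kappa> (a \<union> b) \<le> \<kappa> a + \<kappa> b"
proof -
  have "\<kappa> (a \<union> b) = \<kappa> a + \<kappa> (b - a)" using assms add[of a "b - a"] by auto
  then show ?thesis using mono[of "b - a" b] assms by auto
qed

lemma subadd_finite:
  assumes "finite I" "\<And>i. i \<in> I \<Longrightarrow> c i \<in> A"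
  shows "\<kappa> (\<Union>i\<in>I. c i) \<le> (\<Sum>i\<in>I. \<kappa> (c i))"
  using assms
proof (induction I rule: finite_induct)
  case (insert i I)
  then have "\<kappa> (c i \<union> (\<Union>i\<in>I. c i)) \<le> \<kappa> (c i) + \<kappa> (\<Union>i\<in>I. c i)"
    by (intro subadd) auto
  with insert show ?case by auto
qed (simp add: empty)

lemma sum_disjoint:
  assumes "finite I" "\<And>i. i \<in> I \<Longrightarrow> c i \<in> A" "disjoint_family_on c I"
  shows "\<kappa> (\<Union>i\<in>I. c i) = (\<Sum>i\<in>I. \<kappa> (c i))"
  using assms
proof (induction I rule: finite_induct)
  case (insert i I)
  have "\<kappa> (c i \<union> (\<Union>i\<in>I. c i)) = \<kappa> (c i) + \<kappa> (\<Union>i\<in>I. c i)"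
    using insert.prems insert.hyps
    by (intro add finite_UN) (auto simp: disjoint_family_on_def)
  moreover have "disjoint_family_on c I" using insert.prems(2) by (auto simp: disjoint_family_on_def)
  ultimately show ?case using insert by simp
qed (simp add: empty)

text \<open>
  The Riesz construction: open sets are measured from inside by clopen sets, and arbitrary sets from
  outside by open sets. The Borel sets of \<open>stone\<close> may be strictly more than the \<open>\<sigma>\<close>-algebra generated by the clopen
  sets, so extending \<open>\<kappa>\<close> to the latter would not suffice.
\<close>

definition inner_val :: "'x set set set \<Rightarrow> ennreal" where
  "inner_val U = (SUP a\<in>{a \<in> A. clop a \<subseteq> U}. ennreal (\<kappa> a))"

definition outer :: "'x set set set \<Rightarrow> ennreal" where
  "outer E = (INF U\<in>{U. openin stone U \<and> E \<subseteq> U}. inner_val U)"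

lemma inner_mono: "U \<subseteq> V \<Longrightarrow> inner_val U \<le> inner_val V"
  unfolding inner_val_def by (rule SUP_subset_mono) auto

lemma inner_clop: "a \<in> A \<Longrightarrow> inner_val (clop a) = ennreal (\<kappa> a)"
  unfolding inner_val_def
  by (rule antisym) (auto intro!: SUP_least SUP_upper ennreal_leI mono simp: clop_subset_iff)

lemma inner_le: "a \<in> A \<Longrightarrow> clop a \<subseteq> U \<Longrightarrow> ennreal (\<kappa> a) \<le> inner_val U"
  unfolding inner_val_def by (rule SUP_upper) auto

text \<open>
  Compactness: a clopen subset of the union is a finite union of clopen pieces, each inside
  one of the open sets.
\<close>

lemma inner_UN:
  assumes "\<And>i::nat. openin stone (U i)"
  shows "inner_val (\<Union>i. U i) \<le> (\<Sum>i. inner_val (U i))"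
  unfolding inner_val_def[of "\<Union>i. U i"]
proof (rule SUP_least, clarsimp)
  fix a assume "a \<in> A" "clop a \<subseteq> (\<Union>i. U i)"
  then obtain I c where I: "finite I" "\<And>i. i \<in> I \<Longrightarrow> c i \<in> A" "\<And>i. i \<in> I \<Longrightarrow> clop (c i) \<subseteq> U i"
    "a = (\<Union>i\<in>I. c i)"
    using compact_clop_cover[of a U] assms by metis
  have "ennreal (\<kappa> a) \<le> ennreal (\<Sum>i\<in>I. \<kappa> (c i))"
    using I by (auto intro!: ennreal_leI subadd_finite)
  also have "\<dots> = (\<Sum>i\<in>I. ennreal (\<kappa> (c i)))"
    using I by (subst sum_ennreal) (auto intro: nonneg)
  also have "\<dots> \<le> (\<Sum>i\<in>I. inner_val (U i))"
    using I by (intro sum_mono inner_le) auto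
  also have "\<dots> \<le> (\<Sum>i. inner_val (U i))"
    using I by (intro sum_le_suminf) auto
  finally show "ennreal (\<kappa> a) \<le> (\<Sum>i. inner_val (U i))" .
qed

lemma inner_le_total: "U \<subseteq> points \<Longrightarrow> inner_val U \<le> ennreal (\<kappa> UNIV)"
  using inner_mono[of U points] inner_clop[of UNIV] clop_UNIV by simp

lemma outer_open: "openin stone U \<Longrightarrow> outer U = inner_val U"
  unfolding outer_def by (rule antisym) (auto intro: INF_lower INF_greatest inner_mono)

lemma outer_mono: "E \<subseteq> F \<Longrightarrow> outer E \<le> outer F"
  unfolding outer_def by (rule INF_superset_mono) auto

lemma outer_approx:
  assumes "E \<subseteq> points" "0 < e"
  obtains U where "openin stone U" "E \<subseteq> U" "inner_val U \<le> outer E + ennreal e"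
proof -
  have "outer E \<le> ennreal (\<kappa> UNIV)"
    using outer_mono[OF assms(1)] inner_le_total[of points]
      outer_open[of points] openin_topspace[of stone] by (simp add: topspace_stone)
  then have "outer E < top" using ennreal_less_top order_le_less_trans by blast
  then have "outer E < outer E + ennreal e" using assms(2) 
    by (metis add.right_neutral ennreal_add_left_cancel_less ennreal_less_zero_iff infinity_ennreal_def)
  then obtain U where "openin stone U" "E \<subseteq> U" "inner_val U < outer E + ennreal e"
    unfolding outer_def[of E] INF_less_iff by auto
  with that show thesis by (auto intro: less_imp_le)
qed

lemma outer_measure_space_outer: "outer_measure_space (Pow points) outer"
  unfolding outer_measure_space_def
proof (intro conjI)
  have "outer {} = 0"
    using outer_open[OF openin_empty] inner_clop[of "{}"] by (simp add: clop_empty empty)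
  then show "positive (Pow points) outer" by (simp add: positive_def)
  show "increasing (Pow points) outer" by (auto simp: increasing_def intro: outer_mono)
  show "countably_subadditive (Pow points) outer"
    unfolding countably_subadditive_def
  proof (intro allI impI)
    fix E :: "nat \<Rightarrow> 'x set set set" assume E: "range E \<subseteq> Pow points"
    show "outer (\<Union>i. E i) \<le> (\<Sum>i. outer (E i))"
    proof (rule ennreal_le_epsilon)
      fix e :: real assume "0 < e"
      have "\<exists>U. openin stone U \<and> E i \<subseteq> U \<and> inner_val U \<le> outer (E i) + ennreal (e * (1/2)^Suc i)" for i
        using outer_approx[of "E i" "e * (1/2)^Suc i"] E \<open>0 < e\<close> by (metis PowD UNIV_I half_gt_zero_iff image_subset_iff mult_pos_pos zero_less_one zero_less_power)
      then obtain U where U: "\<And>i. openin stone (U i)" "\<And>i. E i \<subseteq> U i"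
        "\<And>i. inner_val (U i) \<le> outer (E i) + ennreal (e * (1/2)^Suc i)" by metis
      have sums: "(\<lambda>i. e * (1/2)^Suc i) sums e"
        using sums_mult[OF power_half_series, of e] by simp
      have "outer (\<Union>i. E i) \<le> outer (\<Union>i. U i)" using U by (intro outer_mono) blast
      also have "\<dots> = inner_val (\<Union>i. U i)" using U by (intro outer_open) auto
      also have "\<dots> \<le> (\<Sum>i. inner_val (U i))" using U by (intro inner_UN)
      also have "\<dots> \<le> (\<Sum>i. outer (E i) + ennreal (e * (1/2)^Suc i))"
        using U by (intro suminf_le) auto
      also have "\<dots> = (\<Sum>i. outer (E i)) + (\<Sum>i. ennreal (e * (1/2)^Suc i))"
        by (intro suminf_add[symmetric]) auto
      also have "(\<Sum>i. ennreal (e * (1/2)^Suc i)) = ennreal e"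
        using sums \<open>0 < e\<close> by (subst suminf_ennreal2) (auto simp: sums_iff)
      finally show "outer (\<Union>i. E i) \<le> (\<Sum>i. outer (E i)) + ennreal e" .
    qed
  qed
qed

text \<open>
  Caratheodory measurability of an open set \<open>U\<close>. Cover the test set by an open \<open>V\<close>, exhaust \<open>V \<inter> U\<close> by
  a clopen set \<open>clop a\<close>, and use that \<open>V - clop a\<close> is still open and covers the rest.
\<close>

lemma open_in_lambda_system:
  assumes "openin stone U"
  shows "U \<in> lambda_system points (Pow points) outer"
proof -
  interpret P: sigma_algebra points "Pow points" by (rule sigma_algebra_Pow)
  have Us: "U \<subseteq> points" using assms openin_subset topspace_stone by blast
  have split: "outer (E \<inter> U) + outer (E - U) \<le> outer E" if E: "E \<subseteq> points" for E
  proof (rule ennreal_le_epsilon)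
    fix e :: real assume e: "0 < e"
    obtain V where V: "openin stone V" "E \<subseteq> V" "inner_val V \<le> outer E + ennreal (e/2)"
      using outer_approx[OF E, of "e/2"] e by auto
    have VU: "openin stone (V \<inter> U)" using V assms by auto
    have "\<exists>a\<in>A. clop a \<subseteq> V \<inter> U \<and> inner_val (V \<inter> U) \<le> ennreal (\<kappa> a) + ennreal (e/2)"
    proof (rule ccontr)
      assume *: "\<not> ?thesis"
      have fin: "inner_val (V \<inter> U) < top"
        using inner_le_total[of "V \<inter> U"] Us ennreal_less_top order_le_less_trans by blast
      have "inner_val (V \<inter> U) \<le> inner_val (V \<inter> U) - ennreal (e/2)"
        unfolding inner_val_def[of "V \<inter> U"]
      proof (rule SUP_least)
        fix a assume "a \<in> {a \<in> A. clop a \<subseteq> V \<inter> U}"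
        then have "ennreal (\<kappa> a) + ennreal (e/2) \<le> inner_val (V \<inter> U)" using * by auto
        then have "ennreal (\<kappa> a) \<le> inner_val (V \<inter> U) - ennreal (e/2)"
          by (metis add.commute ennreal_le_minus_iff ennreal_less_top less_irrefl)
        then show "ennreal (\<kappa> a) \<le> (SUP a\<in>{a \<in> A. clop a \<subseteq> V \<inter> U}. ennreal (\<kappa> a)) - ennreal (e/2)"
          unfolding inner_val_def .
      qed
      moreover have "clop {} \<subseteq> V \<inter> U" by (simp add: clop_empty)
      then have "\<not> inner_val (V \<inter> U) \<le> ennreal (\<kappa> {}) + ennreal (e/2)" using * by auto
      then have "inner_val (V \<inter> U) > 0" by (auto simp: zero_less_iff_neq_zero)
      moreover obtain r where "inner_val (V \<inter> U) = ennreal r" "0 \<le> r"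
        using fin by (auto simp: less_top_ennreal)
      ultimately show False using e by (auto simp: ennreal_minus ennreal_le_iff2)
    qed
    then obtain a where a: "a \<in> A" "clop a \<subseteq> V \<inter> U"
      "inner_val (V \<inter> U) \<le> ennreal (\<kappa> a) + ennreal (e/2)" by blast
    have Va: "openin stone (V - clop a)" using V a closedin_clop by blast
    have "ennreal (\<kappa> a) + inner_val (V - clop a) \<le> inner_val V"
    proof -
      have "inner_val (V - clop a) \<le> inner_val V - ennreal (\<kappa> a)"
        unfolding inner_val_def[of "V - clop a"]
      proof (rule SUP_least)
        fix b assume b: "b \<in> {b \<in> A. clop b \<subseteq> V - clop a}"
        then have "clop (a \<inter> b) \<subseteq> clop {}" using a by (auto simp: clop_Int)
        then have "a \<inter> b = {}" using clop_subset_iff[of "a \<inter> b" "{}"] a b by auto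
        then have "ennreal (\<kappa> a) + ennreal (\<kappa> b) = ennreal (\<kappa> (a \<union> b))"
          using add a b nonneg by auto
        also have "\<dots> \<le> inner_val V" using a b by (intro inner_le) (auto simp: clop_Un)
        finally show "ennreal (\<kappa> b) \<le> inner_val V - ennreal (\<kappa> a)"
          by (simp add: ennreal_le_minus_iff add.commute)
      qed
      then show ?thesis
        using a inner_le[of a V]
        by (metis (no_types, lifting) add_left_mono add_diff_inverse_ennreal le_inf_iff)
    qed
    moreover have "outer (E \<inter> U) \<le> ennreal (\<kappa> a) + ennreal (e/2)"
    proof -
      have "E \<inter> U \<subseteq> V \<inter> U" using V(2) by blast
      then have "outer (E \<inter> U) \<le> inner_val (V \<inter> U)"
        using outer_open[OF VU] outer_mono by metis
      with a(3) show ?thesis by (rule order_trans[rotated])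
    qed
    moreover have "outer (E - U) \<le> inner_val (V - clop a)"
      using outer_open[OF Va] outer_mono[of "E - U" "V - clop a"] V a by auto
    ultimately have "outer (E \<inter> U) + outer (E - U) \<le> inner_val V + ennreal (e/2)"
      by (smt (verit, ccfv_threshold) add.assoc add.commute add_mono add_right_mono order_trans)
    also have "\<dots> \<le> outer E + ennreal (e/2) + ennreal (e/2)" using V by (intro add_right_mono)
    also have "\<dots> = outer E + ennreal e"
      using e by (simp add: add.assoc ennreal_plus[symmetric] del: ennreal_plus)
    finally show "outer (E \<inter> U) + outer (E - U) \<le> outer E + ennreal e" .
  qed
  have sub: "outer E \<le> outer (E \<inter> U) + outer (E - U)" if E: "E \<subseteq> points" for E
  proof -
    have "subadditive (Pow points) outer"
      using outer_measure_space_outer unfolding outer_measure_space_def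
      by (intro P.countably_subadditive_subadditive) auto
    then have "outer ((E \<inter> U) \<union> (E - U)) \<le> outer (E \<inter> U) + outer (E - U)"
      by (rule subadditiveD) (use E in auto)
    moreover have "(E \<inter> U) \<union> (E - U) = E" by auto
    ultimately show ?thesis by simp
  qed
  show ?thesis
    unfolding P.lambda_system_eq
  proof (intro CollectI conjI ballI)
    show "U \<in> Pow points" using Us by simp
    fix E assume "E \<in> Pow points"
    then show "outer (E \<inter> U) + outer (E - U) = outer E"
      using split[of E] sub[of E] by (intro antisym) auto
  qed
qed

lemma borel_Pow: "borel_sets_of stone \<subseteq> Pow points"
  using borel_sets_of_subset[of _ stone] by (auto simp: topspace_stone)

lemma outer_measure_space_borel: "measure_space points (borel_sets_of stone) outer"
proof (rule measure_down)
  interpret P: sigma_algebra points "Pow points" by (rule sigma_algebra_Pow)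
  show ms: "measure_space points (lambda_system points (Pow points) outer) outer"
    using P.caratheodory_lemma[OF outer_measure_space_outer] .
  show "sigma_algebra points (borel_sets_of stone)"
    using sigma_algebra_borel_sets_of[of stone] by (simp add: topspace_stone)
  show "borel_sets_of stone \<subseteq> lambda_system points (Pow points) outer"
    unfolding borel_sets_of_def topspace_stone
    by (rule sigma_algebra.sigma_sets_subset)
      (use ms open_in_lambda_system in \<open>auto simp: measure_space_def\<close>)
qed

definition ext :: "'x set set measure" where
  "ext = measure_of points (borel_sets_of stone) outer"

lemma space_ext: "space ext = points"
  unfolding ext_def using borel_Pow by (rule space_measure_of)

lemma sets_ext: "sets ext = borel_sets_of stone"
  unfolding ext_def using borel_Pow outer_measure_space_borel
  by (simp add: measure_space_def sigma_algebra.sigma_sets_eq)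

lemma emeasure_ext: "B \<in> borel_sets_of stone \<Longrightarrow> emeasure ext B = outer B"
  using outer_measure_space_borel borel_Pow
  by (intro emeasure_measure_of[OF ext_def]) (auto simp: measure_space_def sets_ext)

lemma finite_ext: "finite_measure ext"
proof (rule finite_measureI)
  have "emeasure ext points = outer points" 
    using emeasure_ext sets_ext space_ext sets.top by metis
  also have "\<dots> = ennreal (\<kappa> UNIV)"
    using outer_open[of points] openin_topspace[of stone] inner_clop[of UNIV]
    by (simp add: topspace_stone clop_UNIV)
  finally show "emeasure ext (space ext) \<noteq> \<infinity>" by (simp add: space_ext)
qed

lemma measure_ext_clop: "a \<in> A \<Longrightarrow> measure ext (clop a) = \<kappa> a"
  by (simp add: measure_def emeasure_ext clop_borel outer_open openin_clop inner_clop nonneg)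

text \<open>
  Outer regularity holds by construction; pass to complements, closed sets being compact.
\<close>

lemma inner_regular_ext:
  assumes "B \<in> borel_sets_of stone" "e > 0"
  shows "\<exists>K. compactin stone K \<and> K \<subseteq> B \<and> measure ext (B - K) < e"
proof -
  interpret finite_measure ext by (rule finite_ext)
  have B: "B \<in> sets ext" "B \<subseteq> points" using assms borel_Pow sets_ext by auto
  obtain V where V: "openin stone V" "points - B \<subseteq> V" 
    "inner_val V \<le> outer (points - B) + ennreal (e/2)"
    using outer_approx[of "points - B" "e/2"] assms by auto
  have Vs: "V \<in> sets ext" using V by (simp add: sets_ext borel_sets_of_def)
  have cB: "points - B \<in> sets ext" using B by (metis sets.compl_sets space_ext)
  have "emeasure ext V \<le> emeasure ext (points - B) + ennreal (e/2)"
    using V Vs cB by (simp add: emeasure_ext sets_ext outer_open)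
  then have "ennreal (measure ext V) \<le> ennreal (measure ext (points - B) + e/2)"
    using assms by (simp add: emeasure_eq_measure)
  then have *: "measure ext V \<le> measure ext (points - B) + e/2"
    using assms by (subst (asm) ennreal_le_iff) (auto intro: add_nonneg_nonneg)
  have "compactin stone (points - V)"
    using V by (intro closedin_compact_space[OF compact_stone] closedin_diff) (auto simp flip: topspace_stone)
  moreover have "points - V \<subseteq> B" using V by auto
  moreover have "measure ext (B - (points - V)) < e"
  proof -
    have "B - (points - V) = V - (points - B)" using B V openin_stone[of V] by auto
    then have "measure ext (B - (points - V)) = measure ext V - measure ext (points - B)"
      using finite_measure_Diff[OF Vs cB V(2)] by simp
    with * assms show ?thesis by simp
  qed
  ultimately show ?thesis by blast
qed

end

section \<open>A gliding hump argument\<close>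

text \<open>
  The hypotheses on \<open>small\<close> are those of a family of negligible-up-to-\<open>\<delta>\<close> sets. The last one is the
  substitute for closure under countable unions: along a subsequence, the union of a disjoint sequence of
  rapidly shrinking sets agrees with a member of the algebra on any prescribed countable set.
\<close>

locale small_union_algebra = algebra K \<C> for K :: "'a set" and \<C> +
  fixes small :: "real \<Rightarrow> 'a set \<Rightarrow> bool"
  assumes separates: "x \<in> K \<Longrightarrow> y \<in> K \<Longrightarrow> x \<noteq> y \<Longrightarrow> \<exists>c\<in>\<C>. x \<in> c \<and> y \<notin> c"
    and small_empty: "0 < \<delta> \<Longrightarrow> small \<delta> {}"
    and small_mono: "c \<in> \<C> \<Longrightarrow> d \<in> \<C> \<Longrightarrow> c \<subseteq> d \<Longrightarrow> small \<delta> d \<Longrightarrow> small \<delta> c"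
    and small_Un: "c \<in> \<C> \<Longrightarrow> d \<in> \<C> \<Longrightarrow> small \<delta> c \<Longrightarrow> small \<epsilon> d \<Longrightarrow> small (\<delta> + \<epsilon>) (c \<union> d)"
    and small_nbhd: "x \<in> K \<Longrightarrow> 0 < \<delta> \<Longrightarrow> \<exists>c\<in>\<C>. x \<in> c \<and> small \<delta> c"
    and small_union: "range a \<subseteq> \<C> \<Longrightarrow> disjoint_family a \<Longrightarrow> (\<And>k. small ((1/2)^k) (a k)) \<Longrightarrow>
      countable D \<Longrightarrow> D \<subseteq> K \<Longrightarrow>
      \<exists>M c. infinite M \<and> c \<in> \<C> \<and> c \<inter> D = (\<Union>k\<in>M. a (k::nat)) \<inter> D"
begin

lemma in_space: "c \<in> \<C> \<Longrightarrow> c \<subseteq> K"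
  using sets_into_space by blast

lemma separate_point:
  "finite H \<Longrightarrow> H \<subseteq> K \<Longrightarrow> x \<in> K - H \<Longrightarrow> \<exists>c\<in>\<C>. x \<in> c \<and> c \<inter> H = {}"
proof (induction H rule: finite_induct)
  case empty
  then show ?case using top by (intro bexI[of _ K]) auto
next
  case (insert y H)
  then obtain c where "c \<in> \<C>" "x \<in> c" "c \<inter> H = {}" by auto
  moreover obtain d where "d \<in> \<C>" "x \<in> d" "y \<notin> d" using separates[of x y] insert by auto
  ultimately show ?case by (intro bexI[of _ "c \<inter> d"]) auto
qed

lemma separate_finite:
  "finite F \<Longrightarrow> finite H \<Longrightarrow> F \<subseteq> K \<Longrightarrow> H \<subseteq> K \<Longrightarrow> F \<inter> H = {} \<Longrightarrow> \<exists>c\<in>\<C>. F \<subseteq> c \<and> c \<inter> H = {}"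
proof (induction F rule: finite_induct)
  case empty
  then show ?case by (intro bexI[of _ "{}"]) auto
next
  case (insert x F)
  then obtain c where "c \<in> \<C>" "F \<subseteq> c" "c \<inter> H = {}" by auto
  moreover obtain d where "d \<in> \<C>" "x \<in> d" "d \<inter> H = {}" using separate_point[of H x] insert by auto
  ultimately show ?case by (intro bexI[of _ "c \<union> d"]) auto
qed

lemma small_finite_nbhd:
  "finite G \<Longrightarrow> G \<subseteq> K \<Longrightarrow> 0 < \<delta> \<Longrightarrow> \<exists>c\<in>\<C>. G \<subseteq> c \<and> small \<delta> c"
proof (induction G arbitrary: \<delta> rule: finite_induct)
  case empty
  then show ?case using small_empty by (intro bexI[of _ "{}"]) auto
next
  case (insert x G)
  obtain c where c: "c \<in> \<C>" "G \<subseteq> c" "small (\<delta>/2) c" using insert.IH[of "\<delta>/2"] insert.prems by auto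
  obtain d where d: "d \<in> \<C>" "x \<in> d" "small (\<delta>/2) d" using small_nbhd[of x "\<delta>/2"] insert.prems by auto
  have "small \<delta> (c \<union> d)" using small_Un[OF c(1) d(1) c(3) d(3)] by simp
  then show ?case using c d by (intro bexI[of _ "c \<union> d"]) auto
qed

text \<open>
  Along a free ultrafilter \<open>G\<close>, the functions \<open>\<beta> k\<close> converge pointwise to some \<open>b\<close>, and
  their masses on every set \<open>E\<close> to some finitely additive \<open>\<Lambda> E\<close>.

  A fixed amount \<open>\<epsilon>\<close> of mass stays off some finite set \<open>S\<close> that carries nearly all of \<open>b\<close>. If \<open>b\<close> is zero this is
  clear. Otherwise let \<open>b z \<noteq> 0\<close> and let \<open>u\<close> be a neighbourhood of \<open>z\<close> that meets \<open>S\<close> in \<open>z\<close> only: the sums over \<open>u\<close> tend to \<open>0\<close>,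
  so outside \<open>S\<close> there must be something that compensates for \<open>b z\<close>.

  At most countably many points have no neighbourhoods of small \<open>\<Lambda>\<close>, and the infima \<open>t x\<close> of
  \<open>\<Lambda>\<close> over the neighbourhoods of \<open>x\<close> have sum at most \<open>1\<close>. So off a finite set \<open>T\<close> all finite sets have
  neighbourhoods with \<open>\<Lambda>\<close> as small as desired.

  A hump is then found as follows. For \<open>G\<close>-many \<open>j\<close> the function \<open>\<beta> j\<close> has little mass on \<open>T - S\<close> and on the union \<open>U\<close> of the
  neighbourhoods chosen so far; cover nearly all of its mass off \<open>S\<close> by a new neighbourhood of a finite
  set \<open>F\<close> that is disjoint from \<open>T\<close>, with \<open>\<Lambda>\<close> so small that \<open>\<Lambda>\<close> of the new union stays below \<open>\<eta>\<close>, and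
  inside it choose a small neighbourhood \<open>w\<close> of the part of \<open>F\<close> with the predominant sign.
  The sets \<open>w\<close> minus the earlier unions are disjoint; the \<open>k\<close>-th function is large on the \<open>k\<close>-th of them and
  has small total mass on all the others.
\<close>

lemma normalized_null_sequence_contradiction:
  fixes \<beta> :: "nat \<Rightarrow> 'a \<Rightarrow> real"
  assumes sm: "\<And>k. \<beta> k summable_on K" and norm1: "\<And>k. mass (\<beta> k) K = 1"
    and null: "\<And>c. c \<in> \<C> \<Longrightarrow> (\<lambda>k. infsum (\<beta> k) c) \<longlonglongrightarrow> 0"
  shows False
proof -
  have "sequentially \<noteq> bot" by simp
  then obtain G :: "nat filter" where G: "ultra G" "G \<le> sequentially"
    using ultra_refines by blast
  have nb: "G \<noteq> bot" using G by (simp add: ultra_def)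
  have Gseq: "(h \<longlongrightarrow> l) G" if "h \<longlonglongrightarrow> l" for h :: "nat \<Rightarrow> real" and l
    using that G(2) by (rule tendsto_mono[rotated])
  have V1: "mass (\<beta> k) E \<in> {0..1}" if "E \<subseteq> K" for k E
    using mass_nonneg[OF sm] mass_mono[OF sm that] norm1 by (metis atLeastAtMost_iff order_refl)
  have "\<forall>E. \<exists>l. E \<subseteq> K \<longrightarrow> ((\<lambda>k. mass (\<beta> k) E) \<longlongrightarrow> l) G"
  proof
    fix E show "\<exists>l. E \<subseteq> K \<longrightarrow> ((\<lambda>k. mass (\<beta> k) E) \<longlongrightarrow> l) G"
      using ultra_bounded_tendsto[OF G(1), of "\<lambda>k. mass (\<beta> k) E" 0 1] V1[of E] by blast
  qed
  then obtain \<Lambda> where \<Lambda>: "\<And>E. E \<subseteq> K \<Longrightarrow> ((\<lambda>k. mass (\<beta> k) E) \<longlongrightarrow> \<Lambda> E) G" by metis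
  have point: "\<bar>\<beta> k x\<bar> \<le> 1" if "x \<in> K" for k x
    using V1[of "{x}" k] that mass_finite[OF sm, of "{x}" k] by simp
  have "\<forall>x. \<exists>l. x \<in> K \<longrightarrow> ((\<lambda>k. \<beta> k x) \<longlongrightarrow> l) G"
  proof
    fix x show "\<exists>l. x \<in> K \<longrightarrow> ((\<lambda>k. \<beta> k x) \<longlongrightarrow> l) G"
    proof (cases "x \<in> K")
      case True
      then have "\<beta> k x \<in> {-1..1}" for k using point[OF True, of k] by (auto simp: abs_le_iff)
      then show ?thesis using ultra_bounded_tendsto[OF G(1), of "\<lambda>k. \<beta> k x" "-1" 1] by blast
    qed auto
  qed
  then obtain b where b: "\<And>x. x \<in> K \<Longrightarrow> ((\<lambda>k. \<beta> k x) \<longlongrightarrow> b x) G" by metis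
  have mass_lim: "((\<lambda>k. mass (\<beta> k) F) \<longlongrightarrow> (\<Sum>x\<in>F. \<bar>b x\<bar>)) G" if "finite F" "F \<subseteq> K" for F
    unfolding mass_finite[OF sm that(1)] using that b by (intro tendsto_intros) auto
  have "(\<Sum>x\<in>F. \<bar>b x\<bar>) \<le> 1" if "finite F" "F \<subseteq> K" for F
    using tendsto_upperbound[OF mass_lim[OF that], of 1] V1[OF that(2)] nb by simp
  then have bs: "b summable_on K"
    unfolding summable_on_iff_abs_summable_on_real[of b] abs_summable_iff_bdd_above
    by (auto intro!: bdd_aboveI[of _ 1])

  \<comment> \<open>Mass escapes from finite sets. The factor \<open>1/40\<close> leaves room for the error terms of the hump.\<close>
  obtain S \<epsilon> where S: "finite S" "S \<subseteq> K" and \<epsilon>: "0 < \<epsilon>"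
    and Sb: "mass b (K - S) \<le> \<epsilon>/40" and Sev: "eventually (\<lambda>k. \<epsilon> \<le> mass (\<beta> k) (K - S)) G"
  proof (cases "\<forall>x\<in>K. b x = 0")
    case True
    then have "mass b K = infsum (\<lambda>x. 0) K" unfolding mass_def by (intro infsum_cong) auto
    then have "mass b K = 0" by simp
    then show thesis using that[of "{}" 1] norm1 by simp
  next
    case False
    then obtain z where z: "z \<in> K" "b z \<noteq> 0" by auto
    define \<epsilon> where "\<epsilon> = \<bar>b z\<bar> / 2"
    have e: "0 < \<epsilon>" using z by (simp add: \<epsilon>_def)
    obtain S0 where S0: "finite S0" "S0 \<subseteq> K" "mass b (K - S0) \<le> \<epsilon>/40"
      using mass_tail[OF bs, of K "\<epsilon>/40"] e by auto
    define S where "S = insert z S0"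
    have S: "finite S" "S \<subseteq> K" using S0 z by (auto simp: S_def)
    have "mass b (K - S) \<le> mass b (K - S0)" by (rule mass_mono[OF bs]) (auto simp: S_def)
    then have Sb: "mass b (K - S) \<le> \<epsilon>/40" using S0 by simp
    obtain u where u: "u \<in> \<C>" "z \<in> u" "u \<inter> (S - {z}) = {}"
      using separate_point[of "S - {z}" z] S z by auto
    have uK: "u \<subseteq> K" using u in_space by blast
    have split: "infsum (\<beta> k) u = \<beta> k z + infsum (\<beta> k) (u - S)" for k
    proof -
      have "u = {z} \<union> (u - S)" using u z by (auto simp: S_def)
      then have "infsum (\<beta> k) u = infsum (\<beta> k) {z} + infsum (\<beta> k) (u - S)"
        using sum_Un_disjoint[OF sm, of "{z}" "u - S" k] z uK by (auto simp: S_def)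
      then show ?thesis by simp
    qed
    have "((\<lambda>k. infsum (\<beta> k) u - \<beta> k z) \<longlongrightarrow> 0 - b z) G"
      using u z by (intro tendsto_diff Gseq null b) auto
    then have "((\<lambda>k. \<bar>infsum (\<beta> k) (u - S)\<bar>) \<longlongrightarrow> \<bar>b z\<bar>) G"
      using tendsto_rabs by (fastforce simp: split)
    moreover have "\<epsilon> < \<bar>b z\<bar>" using z by (simp add: \<epsilon>_def)
    ultimately have "eventually (\<lambda>k. \<epsilon> < \<bar>infsum (\<beta> k) (u - S)\<bar>) G" by (rule order_tendstoD)
    then have "eventually (\<lambda>k. \<epsilon> \<le> mass (\<beta> k) (K - S)) G"
    proof (rule eventually_mono)
      fix k assume "\<epsilon> < \<bar>infsum (\<beta> k) (u - S)\<bar>"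
      also have "\<dots> \<le> mass (\<beta> k) (u - S)" using uK by (intro abs_infsum_le_mass[OF sm]) auto
      also have "\<dots> \<le> mass (\<beta> k) (K - S)" using uK by (intro mass_mono[OF sm]) auto
      finally show "\<epsilon> \<le> mass (\<beta> k) (K - S)" by simp
    qed
    then show thesis using that S Sb e by blast
  qed
  define \<eta> where "\<eta> = \<epsilon>/40"
  have \<eta>: "0 < \<eta>" "\<epsilon> = 40 * \<eta>" using \<epsilon> by (auto simp: \<eta>_def)

  \<comment> \<open>Off a finite set, finite sets have neighbourhoods of small limit mass.\<close>
  have \<Lambda>_nonneg: "0 \<le> \<Lambda> E" if "E \<subseteq> K" for E
    using tendsto_lowerbound[OF \<Lambda>[OF that], of 0] mass_nonneg[OF sm] nb by simp
  have \<Lambda>_Un: "\<Lambda> (E \<union> F) = \<Lambda> E + \<Lambda> F" if "E \<subseteq> K" "F \<subseteq> K" "E \<inter> F = {}" for E F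
  proof (rule tendsto_unique[OF nb])
    show "((\<lambda>k. mass (\<beta> k) (E \<union> F)) \<longlongrightarrow> \<Lambda> (E \<union> F)) G" using that by (intro \<Lambda>) auto
    show "((\<lambda>k. mass (\<beta> k) (E \<union> F)) \<longlongrightarrow> \<Lambda> E + \<Lambda> F) G"
      unfolding mass_Un_disjoint[OF sm that] using that by (intro tendsto_add \<Lambda>) auto
  qed
  have \<Lambda>_Un_le: "\<Lambda> (E \<union> F) \<le> \<Lambda> E + \<Lambda> F" if "E \<subseteq> K" "F \<subseteq> K" for E F
  proof -
    have "F - E \<subseteq> K" "F \<inter> E \<subseteq> K" "(F - E) \<inter> (F \<inter> E) = {}" using that by auto
    then show ?thesis
      using \<Lambda>_Un[of E "F - E"] \<Lambda>_Un[of "F - E" "F \<inter> E"] \<Lambda>_nonneg[of "F \<inter> E"] that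
      by (auto simp: Un_Diff_Int)
  qed
  have \<Lambda>_mono: "\<Lambda> E \<le> \<Lambda> F" if "E \<subseteq> F" "F \<subseteq> K" for E F
  proof -
    have "E \<union> (F - E) = F" "E \<subseteq> K" "F - E \<subseteq> K" using that by auto
    then show ?thesis using \<Lambda>_Un[of E "F - E"] \<Lambda>_nonneg[of "F - E"] that by auto
  qed
  define t where "t x = Inf {\<Lambda> c |c. c \<in> \<C> \<and> x \<in> c}" for x
  have bdd: "bdd_below {\<Lambda> c |c. c \<in> \<C> \<and> x \<in> c}" for x
    using \<Lambda>_nonneg in_space by (intro bdd_belowI[of _ 0]) blast
  have t_le: "t x \<le> \<Lambda> c" if "c \<in> \<C>" "x \<in> c" for x c
    unfolding t_def using that by (intro cInf_lower bdd) auto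
  have t_nonneg: "0 \<le> t x" if "x \<in> K" for x
    unfolding t_def using that top \<Lambda>_nonneg in_space by (intro cInf_greatest) blast+
  have t_approx: "\<exists>c\<in>\<C>. x \<in> c \<and> \<Lambda> c < t x + d" if "x \<in> K" "0 < d" for x d
    using cInf_lessD[of "{\<Lambda> c |c. c \<in> \<C> \<and> x \<in> c}" "t x + d"] that top
    unfolding t_def[symmetric] by auto
  have t_sum: "(\<Sum>x\<in>F. t x) \<le> \<Lambda> c" if "finite F" "c \<in> \<C>" "F \<subseteq> c" for F c
    using that
  proof (induction F arbitrary: c rule: finite_induct)
    case empty
    then show ?case using \<Lambda>_nonneg in_space by simp
  next
    case (insert x F)
    have cK: "c \<subseteq> K" using insert in_space by blast
    obtain v where v: "v \<in> \<C>" "x \<in> v" "v \<inter> F = {}"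
      using separate_point[of F x] insert cK by auto
    have "(\<Sum>x\<in>F. t x) \<le> \<Lambda> (c - v)" using v insert by (intro insert.IH) auto
    moreover have "t x \<le> \<Lambda> (c \<inter> v)" using v insert by (intro t_le) auto
    moreover have "\<Lambda> c = \<Lambda> (c - v) + \<Lambda> (c \<inter> v)"
      using \<Lambda>_Un[of "c - v" "c \<inter> v"] cK by (auto simp: Un_Diff_Int)
    ultimately show ?case using insert by simp
  qed
  have "(\<lambda>x. t x) summable_on K"
    using t_sum[OF _ top] t_nonneg
    by (intro nonneg_bdd_above_summable_on) (auto intro!: bdd_aboveI[of _ "\<Lambda> K"])
  then have ts: "t summable_on K" .
  have quiet: "\<exists>T. finite T \<and> T \<subseteq> K \<and> (\<forall>F. finite F \<longrightarrow> F \<subseteq> K - T \<longrightarrow> (\<exists>u\<in>\<C>. F \<subseteq> u \<and> \<Lambda> u < d))"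
    if d: "0 < d" for d
  proof -
    obtain T where T: "finite T" "T \<subseteq> K" "mass t (K - T) \<le> d/2"
      using mass_tail[OF ts, of K "d/2"] d by auto
    have nb: "\<exists>u\<in>\<C>. F \<subseteq> u \<and> \<Lambda> u < (\<Sum>x\<in>F. t x) + r" if "finite F" "F \<subseteq> K" "0 < r" for F r
      using that
    proof (induction F arbitrary: r rule: finite_induct)
      case empty
      have "\<Lambda> {} = 0" using \<Lambda>_Un[of "{}" "{}"] by simp
      then show ?case using empty by (intro bexI[of _ "{}"]) auto
    next
      case (insert x F)
      obtain u where u: "u \<in> \<C>" "F \<subseteq> u" "\<Lambda> u < (\<Sum>x\<in>F. t x) + r/2"
        using insert.IH[of "r/2"] insert.prems by auto
      obtain v where v: "v \<in> \<C>" "x \<in> v" "\<Lambda> v < t x + r/2"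
        using t_approx[of x "r/2"] insert.prems by auto
      have "\<Lambda> (u \<union> v) \<le> \<Lambda> u + \<Lambda> v" using u v in_space by (intro \<Lambda>_Un_le) auto
      then show ?case using u v insert.hyps by (intro bexI[of _ "u \<union> v"]) auto
    qed
    have "\<exists>u\<in>\<C>. F \<subseteq> u \<and> \<Lambda> u < d" if F: "finite F" "F \<subseteq> K - T" for F
    proof -
      obtain u where u: "u \<in> \<C>" "F \<subseteq> u" "\<Lambda> u < (\<Sum>x\<in>F. t x) + d/2"
        using nb[of F "d/2"] F d by auto
      have "(\<Sum>x\<in>F. t x) = mass t F"
        using F t_nonneg by (subst mass_finite[OF ts]) (auto intro!: sum.cong)
      also have "\<dots> \<le> mass t (K - T)" using F by (intro mass_mono[OF ts]) auto
      finally show ?thesis using u T by (intro bexI[of _ u]) auto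
    qed
    with T show ?thesis by blast
  qed

  \<comment> \<open>A state \<open>(j, U, w)\<close> consists of the index of the last hump, the union of all neighbourhoods so far,
    and the small set that carries the hump. \<open>P\<close> is the invariant and \<open>Q\<close> the transition.\<close>
  define P where "P = (\<lambda>(j::nat, U, w::'a set). U \<in> \<C> \<and> \<Lambda> U < \<eta> \<and> U \<inter> S = {})"
  define Q where "Q = (\<lambda>n (j, U, w::'a set) (j', U', w'). j < j' \<and> U \<subseteq> U' \<and> mass (\<beta> j') U < \<eta> \<and>
     w' \<in> \<C> \<and> w' \<subseteq> U' \<and> small ((1/2)^n) w' \<and> 15 * \<eta> \<le> \<bar>infsum (\<beta> j') w'\<bar> \<and>
     mass (\<beta> j') (K - S - U') \<le> 3 * \<eta>)"
  have step: "\<exists>y. P y \<and> Q n x y" if Px: "P x" for n x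
  proof -
    obtain j U w where x: "x = (j, U, w)" by (cases x) auto
    have U: "U \<in> \<C>" "\<Lambda> U < \<eta>" "U \<inter> S = {}" "U \<subseteq> K" using Px in_space by (auto simp: P_def x)
    obtain T where T: "finite T" "T \<subseteq> K"
      and Tq: "\<And>F. finite F \<Longrightarrow> F \<subseteq> K - T \<Longrightarrow> \<exists>u\<in>\<C>. F \<subseteq> u \<and> \<Lambda> u < \<eta> - \<Lambda> U"
      using quiet[of "\<eta> - \<Lambda> U"] U(2) by auto
    have "(\<Sum>x\<in>T - S. \<bar>b x\<bar>) = mass b (T - S)" using T by (subst mass_finite[OF bs]) auto
    also have "\<dots> \<le> mass b (K - S)" using T by (intro mass_mono[OF bs]) auto
    also have "\<dots> < 2 * \<eta>" using Sb \<eta> by simp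
    finally have "(\<Sum>x\<in>T - S. \<bar>b x\<bar>) < 2 * \<eta>" .
    then have e1: "eventually (\<lambda>k. mass (\<beta> k) (T - S) < 2 * \<eta>) G"
      using T by (intro order_tendstoD(2)[OF mass_lim]) auto
    have e2: "eventually (\<lambda>k. mass (\<beta> k) U < \<eta>) G"
      using U by (intro order_tendstoD(2)[OF \<Lambda>]) auto
    have e3: "eventually (\<lambda>k. j < k) G"
      using G(2) eventually_gt_at_top[of j] by (auto simp: le_filter_def)
    have "eventually (\<lambda>k. mass (\<beta> k) (T - S) < 2 * \<eta> \<and> mass (\<beta> k) U < \<eta> \<and> j < k \<and>
      \<epsilon> \<le> mass (\<beta> k) (K - S)) G"
      using e1 e2 e3 Sev by (intro eventually_conj)
    then obtain j' where j': "mass (\<beta> j') (T - S) < 2 * \<eta>" "mass (\<beta> j') U < \<eta>" "j < j'"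
      "\<epsilon> \<le> mass (\<beta> j') (K - S)"
      using eventually_happens nb by blast
    note mono' = mass_mono[OF sm, of _ _ j']
    note Un' = mass_Un_disjoint[OF sm, of _ _ j']
    obtain F where F: "finite F" "F \<subseteq> K - S - T" "mass (\<beta> j') (K - S - T - F) \<le> \<eta>"
      using mass_tail[OF sm, of "K - S - T" \<eta> j'] \<eta> by auto
    have "mass (\<beta> j') (K - S - F) \<le> mass (\<beta> j') ((T - S) \<union> (K - S - T - F))"
      using T by (intro mono') auto
    also have "\<dots> \<le> mass (\<beta> j') (T - S) + mass (\<beta> j') (K - S - T - F)"
      using T by (intro mass_Un_le[OF sm]) auto
    finally have rest: "mass (\<beta> j') (K - S - F) \<le> 3 * \<eta>" using F j' by simp
    have "mass (\<beta> j') (K - S) = mass (\<beta> j') F + mass (\<beta> j') (K - S - F)"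
      using Un'[of F "K - S - F"] F by (auto simp: Un_absorb1 subset_iff intro: arg_cong[where f = "mass (\<beta> j')"])
    then have massF: "37 * \<eta> \<le> (\<Sum>x\<in>F. \<bar>\<beta> j' x\<bar>)"
      using rest j' \<eta> F by (simp add: mass_finite[OF sm])
    \<comment> \<open>One of the two signs carries at least half of the mass on \<open>F\<close>.\<close>
    obtain H where H: "H \<subseteq> F" "37/2 * \<eta> \<le> \<bar>\<Sum>x\<in>H. \<beta> j' x\<bar>"
    proof -
      define H where "H = {x \<in> F. 0 \<le> \<beta> j' x}"
      have "(\<Sum>x\<in>F. \<bar>\<beta> j' x\<bar>) = (\<Sum>x\<in>H. \<bar>\<beta> j' x\<bar>) + (\<Sum>x\<in>F - H. \<bar>\<beta> j' x\<bar>)"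
        using F by (subst sum.subset_diff[of H F]) (auto simp: H_def)
      also have "(\<Sum>x\<in>H. \<bar>\<beta> j' x\<bar>) = (\<Sum>x\<in>H. \<beta> j' x)" by (auto simp: H_def intro!: sum.cong)
      also have "(\<Sum>x\<in>F - H. \<bar>\<beta> j' x\<bar>) = - (\<Sum>x\<in>F - H. \<beta> j' x)"
        by (auto simp: H_def sum_negf[symmetric] intro!: sum.cong)
      finally have "37/2 * \<eta> \<le> \<bar>\<Sum>x\<in>H. \<beta> j' x\<bar> \<or> 37/2 * \<eta> \<le> \<bar>\<Sum>x\<in>F - H. \<beta> j' x\<bar>"
        using massF by linarith
      moreover have "H \<subseteq> F" "F - H \<subseteq> F" by (auto simp: H_def)
      ultimately show thesis using that by blast
    qed
    obtain u where u: "u \<in> \<C>" "F \<subseteq> u" "\<Lambda> u < \<eta> - \<Lambda> U"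
      using Tq[of F] F by auto
    obtain v where v: "v \<in> \<C>" "F \<subseteq> v" "v \<inter> S = {}"
      using separate_finite[of F S] F S by auto
    obtain v' where v': "v' \<in> \<C>" "H \<subseteq> v'" "v' \<inter> (F - H) = {}"
      using separate_finite[of H "F - H"] F H by (auto dest: finite_subset)
    obtain s where s: "s \<in> \<C>" "H \<subseteq> s" "small ((1/2)^n) s"
      using small_finite_nbhd[of H "(1/2)^n"] F H by (auto dest: finite_subset)
    define U' where "U' = U \<union> (u \<inter> v)"
    define w' where "w' = s \<inter> v' \<inter> (u \<inter> v)"
    have U'C: "U' \<in> \<C>" and w'C: "w' \<in> \<C>" using U u v v' s by (auto simp: U'_def w'_def)
    have uvK: "u \<subseteq> K" "v \<subseteq> K" using u v in_space by auto
    have "\<Lambda> U' \<le> \<Lambda> U + \<Lambda> (u \<inter> v)" unfolding U'_def using U uvK by (intro \<Lambda>_Un_le) auto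
    also have "\<Lambda> (u \<inter> v) \<le> \<Lambda> u" using uvK by (intro \<Lambda>_mono) auto
    finally have "\<Lambda> U' < \<eta>" using u by simp
    moreover have "U' \<inter> S = {}" using U v by (auto simp: U'_def)
    ultimately have Py: "P (j', U', w')" using U'C by (simp add: P_def)
    have Hw: "H \<subseteq> w'" using s v' u v H by (auto simp: w'_def)
    have w'K: "w' \<subseteq> K" "w' - H \<subseteq> K" using w'C in_space by blast+
    have "mass (\<beta> j') (w' - H) \<le> mass (\<beta> j') (K - S - F)"
      using v v' w'K by (intro mono') (auto simp: w'_def)
    then have "\<bar>infsum (\<beta> j') (w' - H)\<bar> \<le> 3 * \<eta>"
      using rest abs_infsum_le_mass[OF sm, of "w' - H" j'] w'K by auto
    moreover have "infsum (\<beta> j') w' = infsum (\<beta> j') H + infsum (\<beta> j') (w' - H)"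
    proof -
      have "H \<union> (w' - H) = w'" using Hw by auto
      then show ?thesis using sum_Un_disjoint[OF sm, of H "w' - H" j'] w'K Hw by auto
    qed
    moreover have "finite H" using F H finite_subset by blast
    ultimately have big: "15 * \<eta> \<le> \<bar>infsum (\<beta> j') w'\<bar>" using H \<eta> by simp
    have "mass (\<beta> j') (K - S - U') \<le> mass (\<beta> j') (K - S - F)"
      using u v by (intro mono') (auto simp: U'_def)
    moreover have "small ((1/2)^n) w'" by (rule small_mono[OF w'C s(1) _ s(3)]) (auto simp: w'_def)
    moreover have "U \<subseteq> U'" "w' \<subseteq> U'" by (auto simp: U'_def w'_def)
    ultimately have "Q n x (j', U', w')" using rest j' w'C big by (simp add: Q_def x)
    with Py show ?thesis by blast
  qed
  have P0: "P (0, {}, {})" using \<eta> \<Lambda>_Un[of "{}" "{}"] by (simp add: P_def)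
  obtain g where g: "\<And>n. P (g n)" "\<And>n. Q n (g n) (g (Suc n))"
    using dependent_nat_choice[of "\<lambda>_. P" Q, OF exI[of P, OF P0] step] by blast
  define j where "j n = fst (g n)" for n
  define U where "U n = fst (snd (g n))" for n
  define w where "w n = snd (snd (g n))" for n
  have g_eq: "g n = (j n, U n, w n)" for n by (simp add: j_def U_def w_def)
  have U: "U n \<in> \<C>" "U n \<inter> S = {}" for n using g(1)[of n] by (auto simp: P_def g_eq)
  have q: "j n < j (Suc n)" "U n \<subseteq> U (Suc n)" "mass (\<beta> (j (Suc n))) (U n) < \<eta>"
    "w (Suc n) \<in> \<C>" "w (Suc n) \<subseteq> U (Suc n)" "small ((1/2)^n) (w (Suc n))"
    "15 * \<eta> \<le> \<bar>infsum (\<beta> (j (Suc n))) (w (Suc n))\<bar>"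
    "mass (\<beta> (j (Suc n))) (K - S - U (Suc n)) \<le> 3 * \<eta>" for n
    using g(2)[of n] by (auto simp: Q_def g_eq)
  have Umono: "U m \<subseteq> U n" if "m \<le> n" for m n using lift_Suc_mono_le[of U, OF q(2) that] .
  define a where "a n = w (Suc n) - U n" for n
  have aC: "a n \<in> \<C>" for n using q(4)[of n] U(1)[of n] by (auto simp: a_def)
  have aU: "a n \<subseteq> U (Suc n)" "a n \<inter> U n = {}" for n using q(5)[of n] by (auto simp: a_def)
  \<comment> \<open>Earlier sets lie in \<open>U k\<close>, later ones avoid both \<open>U (Suc k)\<close> and \<open>S\<close>; on either region the mass of the \<open>k\<close>-th hump function is small.\<close>
  have a_before: "a i \<subseteq> U k" if "i < k" for i k using aU(1)[of i] Umono[of "Suc i" k] that by auto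
  have a_after: "a i \<subseteq> K - S - U (Suc k)" if "k < i" for i k
  proof -
    have "a i \<inter> S = {}" using aU(1)[of i] U(2)[of "Suc i"] by auto
    moreover have "a i \<inter> U (Suc k) = {}" using aU(2)[of i] Umono[of "Suc k" i] that by auto
    ultimately show ?thesis using in_space[OF aC[of i]] by auto
  qed
  have "disjoint_family a"
    unfolding disjoint_family_on_def
  proof (intro ballI impI)
    fix m n :: nat assume "m \<noteq> n"
    then consider "m < n" | "n < m" by linarith
    then show "a m \<inter> a n = {}"
      by cases (use a_before[of m n] a_before[of n m] aU(2)[of n] aU(2)[of m] in blast)+
  qed
  moreover have "small ((1/2)^n) (a n)" for n
    by (rule small_mono[OF aC q(4) _ q(6)]) (auto simp: a_def)
  moreover define D where "D = (\<Union>k. {x \<in> K. \<beta> k x \<noteq> 0})"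
  moreover have "countable D"
    unfolding D_def using sm summable_on_iff_abs_summable_on_real[of "\<beta> k" K for k]
    by (intro countable_UN countableI_type abs_summable_countable) simp
  moreover have "D \<subseteq> K" by (auto simp: D_def)
  moreover have "range a \<subseteq> \<C>" using aC by auto
  ultimately obtain M c where M: "infinite M" and c: "c \<in> \<C>" "c \<inter> D = (\<Union>k\<in>M. a k) \<inter> D"
    using small_union[of a D] by blast
  have cK: "c \<subseteq> K" using c in_space by blast
  have big: "10 * \<eta> \<le> \<bar>infsum (\<beta> (j (Suc k))) c\<bar>" if k: "k \<in> M" for k
  proof -
    let ?\<beta> = "\<beta> (j (Suc k))"
    let ?R = "c \<inter> D - a k"
    have "infsum ?\<beta> c = infsum ?\<beta> (c \<inter> D \<union> a k)"
    proof (rule infsum_cong_neutral)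
      have D0: "?\<beta> x = 0" if "x \<in> K" "x \<notin> D" for x using that by (auto simp: D_def)
      show "?\<beta> x = 0" if "x \<in> (c \<inter> D \<union> a k) - c" for x
      proof (rule D0)
        show "x \<in> K" using that in_space[OF aC[of k]] by auto
        show "x \<notin> D" using that c(2) k by auto
      qed
      show "?\<beta> x = 0" if "x \<in> c - (c \<inter> D \<union> a k)" for x
        using that cK by (intro D0) auto
    qed auto
    also have "\<dots> = infsum ?\<beta> (a k \<union> ?R)" by (simp add: Un_commute)
    also have "\<dots> = infsum ?\<beta> (a k) + infsum ?\<beta> ?R"
      using cK aC[of k] in_space by (intro sum_Un_disjoint[OF sm]) auto
    finally have 1: "infsum ?\<beta> c = infsum ?\<beta> (a k) + infsum ?\<beta> ?R" .
    have "?R \<subseteq> U k \<union> (K - S - U (Suc k))"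
    proof
      fix x assume "x \<in> ?R"
      then obtain i where i: "x \<in> a i" "i \<noteq> k" using c(2) by auto
      then consider "i < k" | "k < i" by linarith
      then show "x \<in> U k \<union> (K - S - U (Suc k))"
        by cases (use i a_before[of i k] a_after[of k i] in blast)+
    qed
    then have "mass ?\<beta> ?R \<le> mass ?\<beta> (U k \<union> (K - S - U (Suc k)))"
      using U(1)[of k] in_space by (intro mass_mono[OF sm]) auto
    also have "\<dots> \<le> mass ?\<beta> (U k) + mass ?\<beta> (K - S - U (Suc k))"
      using U(1)[of k] in_space by (intro mass_Un_le[OF sm]) auto
    finally have "mass ?\<beta> ?R \<le> 4 * \<eta>" using q(3,8)[of k] by simp
    then have 2: "\<bar>infsum ?\<beta> ?R\<bar> \<le> 4 * \<eta>"
      using abs_infsum_le_mass[OF sm, of ?R] cK by (meson Diff_subset Int_lower1 order_trans)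
    have "w (Suc k) = a k \<union> (w (Suc k) \<inter> U k)" by (auto simp: a_def)
    then have "infsum ?\<beta> (w (Suc k)) = infsum ?\<beta> (a k) + infsum ?\<beta> (w (Suc k) \<inter> U k)"
      using sum_Un_disjoint[OF sm, of "a k" "w (Suc k) \<inter> U k"] aC[of k] U(1)[of k] in_space aU(2)[of k]
      by (metis Int_assoc Int_commute Int_empty_right le_infI2)
    moreover have "\<bar>infsum ?\<beta> (w (Suc k) \<inter> U k)\<bar> \<le> mass ?\<beta> (U k)"
      using abs_infsum_le_mass[OF sm, of "w (Suc k) \<inter> U k"]
        mass_mono[OF sm, of "w (Suc k) \<inter> U k" "U k"] U(1)[of k] in_space
      by (meson Int_lower2 order_trans)
    ultimately have "14 * \<eta> \<le> \<bar>infsum ?\<beta> (a k)\<bar>" using q(3,7)[of k] by linarith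
    with 1 2 show ?thesis by linarith
  qed
  have "strict_mono j" using q(1) by (simp add: strict_mono_Suc_iff)
  then have "(\<lambda>n. infsum (\<beta> (j (Suc n))) c) \<longlonglongrightarrow> 0"
    using LIMSEQ_subseq_LIMSEQ[OF null[OF c(1)], of "\<lambda>n. j (Suc n)"]
    by (simp add: strict_mono_def o_def)
  then obtain N where "\<And>n. n \<ge> N \<Longrightarrow> \<bar>infsum (\<beta> (j (Suc n))) c\<bar> < 10 * \<eta>"
    using LIMSEQ_D[of _ 0 "10 * \<eta>"] \<eta> by fastforce
  moreover obtain k where "k \<in> M" "k \<ge> N"
    using M by (meson infinite_nat_iff_unbounded_le)
  ultimately show False using big by fastforce
qed

text \<open>
  If the sequence were not Cauchy in norm, differences of norm at least \<open>e\<close>, divided by their norms, would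
  contradict the previous lemma: dividing by numbers bounded away from \<open>0\<close> preserves convergence to \<open>0\<close>
  on each set.
\<close>

lemma setwise_convergent_imp_norm_convergent:
  fixes \<alpha> :: "nat \<Rightarrow> 'a \<Rightarrow> real"
  assumes sm: "\<And>n. \<alpha> n summable_on K"
    and conv: "\<And>c. c \<in> \<C> \<Longrightarrow> convergent (\<lambda>n. infsum (\<alpha> n) c)"
  obtains a where "a summable_on K" "(\<lambda>n. mass (\<lambda>x. \<alpha> n x - a x) K) \<longlonglongrightarrow> 0"
proof -
  define d where "d m n x = \<alpha> m x - \<alpha> n x" for m n x
  have d_sm: "d m n summable_on K" for m n
    unfolding d_def by (intro summable_on_diff sm)
  have Cau: "\<exists>N. \<forall>m\<ge>N. \<forall>n\<ge>N. mass (d m n) K < e" if e: "0 < e" for e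
  proof (rule ccontr)
    assume "\<not> ?thesis"
    then have "\<forall>N. \<exists>m n. N \<le> m \<and> N \<le> n \<and> e \<le> mass (d m n) K" by (meson not_less)
    then obtain p q where pq: "\<And>N. N \<le> p N" "\<And>N. N \<le> q N" "\<And>N. e \<le> mass (d (p N) (q N)) K"
      by metis
    define r where "r N = mass (d (p N) (q N)) K" for N
    have r: "e \<le> r N" "0 < r N" for N using pq(3)[of N] e by (auto simp: r_def)
    define \<beta> where "\<beta> N x = (1 / r N) * d (p N) (q N) x" for N x
    have \<beta>_sm: "\<beta> N summable_on K" for N
      unfolding \<beta>_def by (intro summable_on_cmult_right d_sm)
    have "mass (\<beta> N) K = 1" for N
    proof -
      have "mass (\<beta> N) K = infsum (\<lambda>x. (1 / r N) * \<bar>d (p N) (q N) x\<bar>) K"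
        unfolding mass_def \<beta>_def using r[of N] by (intro infsum_cong) (simp add: abs_mult)
      also have "\<dots> = (1 / r N) * mass (d (p N) (q N)) K"
        unfolding mass_def by (rule infsum_cmult_right')
      finally show ?thesis using r(2)[of N] by (simp add: r_def)
    qed
    moreover have "(\<lambda>N. infsum (\<beta> N) c) \<longlonglongrightarrow> 0" if c: "c \<in> \<C>" for c
    proof -
      have cK: "c \<subseteq> K" using c in_space by blast
      obtain l where l: "(\<lambda>n. infsum (\<alpha> n) c) \<longlonglongrightarrow> l" using conv[OF c] by (auto simp: convergent_def)
      have "filterlim p at_top at_top" "filterlim q at_top at_top"
        using pq by (auto intro: filterlim_at_top_mono[OF filterlim_ident])
      then have "(\<lambda>N. infsum (\<alpha> (p N)) c - infsum (\<alpha> (q N)) c) \<longlonglongrightarrow> l - l"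
        by (intro tendsto_diff filterlim_compose[OF l])
      then have "(\<lambda>N. (1/e) * \<bar>infsum (\<alpha> (p N)) c - infsum (\<alpha> (q N)) c\<bar>) \<longlonglongrightarrow> (1/e) * \<bar>l - l\<bar>"
        by (rule tendsto_mult[OF tendsto_const tendsto_rabs])
      then have lim: "(\<lambda>N. (1/e) * \<bar>infsum (\<alpha> (p N)) c - infsum (\<alpha> (q N)) c\<bar>) \<longlonglongrightarrow> 0" by simp
      have bound: "\<bar>infsum (\<beta> N) c\<bar> \<le> (1/e) * \<bar>infsum (\<alpha> (p N)) c - infsum (\<alpha> (q N)) c\<bar>" for N
      proof -
        have "infsum (\<beta> N) c = (1 / r N) * infsum (d (p N) (q N)) c"
          unfolding \<beta>_def by (rule infsum_cmult_right')
        also have "infsum (d (p N) (q N)) c = infsum (\<alpha> (p N)) c - infsum (\<alpha> (q N)) c"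
          unfolding d_def using cK by (intro infsum_diff l1_summable[OF sm])
        finally have "\<bar>infsum (\<beta> N) c\<bar> = (1 / r N) * \<bar>infsum (\<alpha> (p N)) c - infsum (\<alpha> (q N)) c\<bar>"
          using r(2)[of N] by (simp add: abs_mult)
        moreover have "1 / r N \<le> 1 / e" using r(1)[of N] e by (intro frac_le) auto
        ultimately show ?thesis by (metis abs_ge_zero mult_right_mono)
      qed
      show ?thesis
        by (rule Lim_null_comparison[OF _ lim]) (use bound in simp)
    qed
    ultimately show False by (rule normalized_null_sequence_contradiction[OF \<beta>_sm])
  qed
  have "convergent (\<lambda>n. \<alpha> n x)" if x: "x \<in> K" for x
    unfolding Cauchy_convergent_iff[symmetric]
  proof (rule CauchyI)
    fix e :: real assume "0 < e"
    then obtain N where N: "\<And>m n. N \<le> m \<Longrightarrow> N \<le> n \<Longrightarrow> mass (d m n) K < e" using Cau by blast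
    have bound: "norm (\<alpha> m x - \<alpha> n x) \<le> mass (d m n) K" for m n
      using mass_mono[OF d_sm, of "{x}" K m n] mass_finite[OF d_sm, of "{x}" m n] x by (simp add: d_def)
    show "\<exists>N. \<forall>m\<ge>N. \<forall>n\<ge>N. norm (\<alpha> m x - \<alpha> n x) < e"
      by (intro exI[of _ N] allI impI le_less_trans[OF bound N])
  qed
  then have "\<forall>x. \<exists>l. x \<in> K \<longrightarrow> (\<lambda>n. \<alpha> n x) \<longlonglongrightarrow> l" by (auto simp: convergent_def)
  then obtain a where a: "\<And>x. x \<in> K \<Longrightarrow> (\<lambda>n. \<alpha> n x) \<longlonglongrightarrow> a x" by metis
  have fin: "(\<Sum>x\<in>F. \<bar>\<alpha> n x - a x\<bar>) \<le> e"
    if N: "\<And>m n. N \<le> m \<Longrightarrow> N \<le> n \<Longrightarrow> mass (d m n) K < e" and n: "N \<le> n" and F: "finite F" "F \<subseteq> K"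
    for N e n F
  proof (rule tendsto_upperbound)
    show "(\<lambda>m. \<Sum>x\<in>F. \<bar>\<alpha> n x - \<alpha> m x\<bar>) \<longlonglongrightarrow> (\<Sum>x\<in>F. \<bar>\<alpha> n x - a x\<bar>)"
      using F a by (intro tendsto_intros) auto
    have "(\<Sum>x\<in>F. \<bar>\<alpha> n x - \<alpha> m x\<bar>) \<le> mass (d n m) K" for m
      using mass_mono[OF d_sm, of F K n m] mass_finite[OF d_sm, of F n m] F by (simp add: d_def)
    then have "(\<Sum>x\<in>F. \<bar>\<alpha> n x - \<alpha> m x\<bar>) \<le> e" if "N \<le> m" for m using N[OF n that] by (meson less_imp_le order_trans)
    then show "eventually (\<lambda>m. (\<Sum>x\<in>F. \<bar>\<alpha> n x - \<alpha> m x\<bar>) \<le> e) sequentially"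
      using eventually_ge_at_top[of N] by (rule eventually_mono[rotated]) 
  qed simp
  have diff_sm: "(\<lambda>x. \<alpha> n x - a x) summable_on K \<and> mass (\<lambda>x. \<alpha> n x - a x) K \<le> e"
    if N: "\<And>m n. N \<le> m \<Longrightarrow> N \<le> n \<Longrightarrow> mass (d m n) K < e" and n: "N \<le> n" for N e n
  proof -
    have "(\<lambda>x. \<bar>\<alpha> n x - a x\<bar>) summable_on K"
      using fin[OF N n] by (intro nonneg_bdd_above_summable_on) (auto intro!: bdd_aboveI[of _ e])
    moreover from this have "mass (\<lambda>x. \<alpha> n x - a x) K \<le> e"
      unfolding mass_def using fin[OF N n] by (intro infsum_le_finite_sums)
    ultimately show ?thesis
      using summable_on_iff_abs_summable_on_real[of "\<lambda>x. \<alpha> n x - a x" K] by simp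
  qed
  obtain N1 where "\<And>m n. N1 \<le> m \<Longrightarrow> N1 \<le> n \<Longrightarrow> mass (d m n) K < 1" using Cau[of 1] by auto
  then have "(\<lambda>x. \<alpha> N1 x - a x) summable_on K" using diff_sm[of N1 1 N1] by simp
  then have "(\<lambda>x. \<alpha> N1 x - (\<alpha> N1 x - a x)) summable_on K" by (rule summable_on_diff[OF sm])
  moreover have "(\<lambda>x. \<alpha> N1 x - (\<alpha> N1 x - a x)) = a" by auto
  ultimately have "a summable_on K" by (simp only:)
  moreover have "(\<lambda>n. mass (\<lambda>x. \<alpha> n x - a x) K) \<longlonglongrightarrow> 0"
  proof (rule LIMSEQ_I)
    fix e :: real assume e: "0 < e"
    then obtain N where N: "\<And>m n. N \<le> m \<Longrightarrow> N \<le> n \<Longrightarrow> mass (d m n) K < e/2" using Cau[of "e/2"] by auto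
    have "norm (mass (\<lambda>x. \<alpha> n x - a x) K - 0) < e" if "N \<le> n" for n
      using diff_sm[OF N that] mass_nonneg[of "\<lambda>x. \<alpha> n x - a x" K] e by auto
    then show "\<exists>N. \<forall>n\<ge>N. norm (mass (\<lambda>x. \<alpha> n x - a x) K - 0) < e" by blast
  qed
  ultimately show thesis by (rule that)
qed

end

section \<open>A finitely additive density\<close>

text \<open>
  The limit of the relative frequencies along a free ultrafilter.
\<close>

lemma udensity_exists:
  "\<exists>\<kappa> :: nat set \<Rightarrow> real. (\<forall>E. 0 \<le> \<kappa> E) \<and> \<kappa> UNIV = 1 \<and>
     (\<forall>E F. E \<inter> F = {} \<longrightarrow> \<kappa> (E \<union> F) = \<kappa> E + \<kappa> F) \<and>
     (\<forall>m r. 0 < m \<longrightarrow> \<kappa> {y. y mod m = r} \<le> 1 / real m)"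
proof -
  have "sequentially \<noteq> bot" by simp
  then obtain G :: "nat filter" where G: "ultra G" "G \<le> sequentially"
    using ultra_refines by blast
  have nb: "G \<noteq> bot" using G by (simp add: ultra_def)
  define avg where "avg E N = real (card (E \<inter> {..<N})) / real N" for E and N :: nat
  have avg01: "avg E N \<in> {0..1}" for E N
  proof -
    have "card (E \<inter> {..<N}) \<le> card {..<N}" by (rule card_mono) auto
    then show ?thesis by (auto simp: avg_def divide_le_eq)
  qed
  have "\<forall>E. \<exists>l. (avg E \<longlongrightarrow> l) G"
  proof
    fix E show "\<exists>l. (avg E \<longlongrightarrow> l) G"
      by (rule ultra_bounded_tendsto[OF G(1) avg01[of E]]) (rule exI)
  qed
  then obtain \<kappa> where \<kappa>: "\<And>E. (avg E \<longlongrightarrow> \<kappa> E) G" by metis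
  have seq: "eventually P G" if "eventually P sequentially" for P
    using that G(2) by (auto simp: le_filter_def)
  have "0 \<le> \<kappa> E" for E
    using tendsto_lowerbound[OF \<kappa>, of 0] avg01 nb by simp
  moreover have "\<kappa> UNIV = 1"
  proof (rule tendsto_unique[OF nb \<kappa>])
    have "eventually (\<lambda>N. avg UNIV N = 1) sequentially"
      using eventually_gt_at_top[of 0] by eventually_elim (simp add: avg_def)
    then show "(avg UNIV \<longlongrightarrow> 1) G" by (intro tendsto_eventually seq)
  qed
  moreover have "\<kappa> (E \<union> F) = \<kappa> E + \<kappa> F" if "E \<inter> F = {}" for E F
  proof (rule tendsto_unique[OF nb \<kappa>])
    have "card ((E \<union> F) \<inter> {..<N}) = card (E \<inter> {..<N}) + card (F \<inter> {..<N})" for N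
      using that by (subst card_Un_disjoint[symmetric]) (auto intro: arg_cong[where f = card])
    then have "avg (E \<union> F) = (\<lambda>N. avg E N + avg F N)" by (auto simp: avg_def add_divide_distrib)
    then show "(avg (E \<union> F) \<longlongrightarrow> \<kappa> E + \<kappa> F) G" by (simp add: tendsto_add[OF \<kappa> \<kappa>])
  qed
  moreover have "\<kappa> {y. y mod m = r} \<le> 1 / real m" if m: "0 < m" for m r
  proof (rule tendsto_le[OF nb _ \<kappa>])
    have "(\<lambda>N. 1 / real m + 1 / real N) \<longlonglongrightarrow> 1 / real m + 0"
      by (intro tendsto_add tendsto_const lim_1_over_n)
    then show "((\<lambda>N. 1 / real m + 1 / real N) \<longlongrightarrow> 1 / real m) G"
      using G(2) by (auto intro: tendsto_mono)
    have "avg {y. y mod m = r} N \<le> 1 / real m + 1 / real N" if "0 < N" for N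
    proof -
      have "card ({y. y mod m = r} \<inter> {..<N}) \<le> card {..N div m}"
      proof (rule card_inj_on_le[where f = "\<lambda>y. y div m"])
        show "inj_on (\<lambda>y. y div m) ({y. y mod m = r} \<inter> {..<N})"
          by (rule inj_onI) (metis (mono_tags, lifting) IntD1 div_mult_mod_eq mem_Collect_eq)
        show "(\<lambda>y. y div m) ` ({y. y mod m = r} \<inter> {..<N}) \<subseteq> {..N div m}"
          by (auto intro: div_le_mono)
      qed simp
      then have "real (card ({y. y mod m = r} \<inter> {..<N})) \<le> real (N div m) + 1" by simp
      also have "real (N div m) \<le> real N / real m" by (rule of_nat_div_le_of_nat)
      finally have "avg {y. y mod m = r} N \<le> (real N / real m + 1) / real N"
        unfolding avg_def using that by (intro divide_right_mono) auto
      also have "\<dots> = 1 / real m + 1 / real N" using that by (simp add: field_simps)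
      finally show ?thesis .
    qed
    then show "eventually (\<lambda>N. avg {y. y mod m = r} N \<le> 1 / real m + 1 / real N) G"
      by (intro seq eventually_mono[OF eventually_gt_at_top[of 0]])
  qed
  ultimately show ?thesis by blast
qed

definition udensity :: "nat set \<Rightarrow> real" where
  "udensity = (SOME \<kappa>. (\<forall>E. 0 \<le> \<kappa> E) \<and> \<kappa> UNIV = 1 \<and>
     (\<forall>E F. E \<inter> F = {} \<longrightarrow> \<kappa> (E \<union> F) = \<kappa> E + \<kappa> F) \<and>
     (\<forall>m r. 0 < m \<longrightarrow> \<kappa> {y. y mod m = r} \<le> 1 / real m))"

lemma udensity_nonneg: "0 \<le> udensity E"
  and udensity_UNIV: "udensity UNIV = 1"
  and udensity_Un: "E \<inter> F = {} \<Longrightarrow> udensity (E \<union> F) = udensity E + udensity F"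
  and udensity_residue: "0 < m \<Longrightarrow> udensity {y. y mod m = r} \<le> 1 / real m"
proof -
  note spec = someI_ex[OF udensity_exists, folded udensity_def]
  show "0 \<le> udensity E" "udensity UNIV = 1" using spec by simp_all
  show "E \<inter> F = {} \<Longrightarrow> udensity (E \<union> F) = udensity E + udensity F" using spec by simp
  show "0 < m \<Longrightarrow> udensity {y. y mod m = r} \<le> 1 / real m" using spec by simp
qed

interpretation udensity: content_on_algebra UNIV udensity
proof -
  have "algebra UNIV (UNIV :: nat set set)" using algebra_Pow[of UNIV] by simp
  then show "content_on_algebra UNIV udensity"
    by (intro content_on_algebra.intro set_algebra.intro content_on_algebra_axioms.intro
      udensity_nonneg udensity_Un)
qed

section \<open>The algebra of balanced sets\<close>

text \<open>
  The natural number coded by \<open>(n, 2 * y + of_bool b)\<close> is the point \<open>y\<close> in copy \<open>b\<close> of fibre \<open>n\<close>.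
\<close>

definition fibre :: "bool \<Rightarrow> nat \<Rightarrow> nat set \<Rightarrow> nat set" where
  "fibre b n E = {y. prod_encode (n, 2 * y + of_bool b) \<in> E}"

lemma fibre_simps:
  "fibre b n UNIV = UNIV" "fibre b n {} = {}" "fibre b n (E \<union> F) = fibre b n E \<union> fibre b n F"
  "fibre b n (E \<inter> F) = fibre b n E \<inter> fibre b n F" "fibre b n (- E) = - fibre b n E"
  "fibre b n (\<Union>i\<in>I. e i) = (\<Union>i\<in>I. fibre b n (e i))"
  by (auto simp: fibre_def)

lemma fibre_mono: "E \<subseteq> F \<Longrightarrow> fibre b n E \<subseteq> fibre b n F"
  by (auto simp: fibre_def)

definition imbalance :: "nat \<Rightarrow> nat set \<Rightarrow> real" where
  "imbalance n E = udensity (sym_diff (fibre False n E) (fibre True n E))"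

definition balanced :: "nat set set" where
  "balanced = {E. (\<lambda>n. imbalance n E) \<longlonglongrightarrow> 0}"

lemma imbalance_nonneg: "0 \<le> imbalance n E"
  by (simp add: imbalance_def udensity_nonneg)

lemma imbalance_Un: "imbalance n (E \<union> F) \<le> imbalance n E + imbalance n F"
proof -
  have "imbalance n (E \<union> F) \<le> udensity (sym_diff (fibre False n E) (fibre True n E) \<union> sym_diff (fibre False n F) (fibre True n F))"
    unfolding imbalance_def by (rule udensity.mono) (auto simp: fibre_simps)
  also have "\<dots> \<le> imbalance n E + imbalance n F" unfolding imbalance_def by (rule udensity.subadd) auto
  finally show ?thesis .
qed

lemma imbalance_le: "imbalance n E \<le> udensity (fibre False n E) + udensity (fibre True n E)"
proof -
  have "imbalance n E \<le> udensity (fibre False n E \<union> fibre True n E)"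
    unfolding imbalance_def by (rule udensity.mono) auto
  also have "\<dots> \<le> udensity (fibre False n E) + udensity (fibre True n E)" by (rule udensity.subadd) auto
  finally show ?thesis .
qed

interpretation balanced: set_algebra balanced
proof -
  have "algebra UNIV balanced"
    unfolding algebra_iff_Un
  proof (intro conjI ballI)
    show "{} \<in> balanced" by (simp add: balanced_def imbalance_def fibre_simps udensity.empty)
    fix E assume E: "E \<in> balanced"
    have "imbalance n (UNIV - E) = imbalance n E" for n
      unfolding imbalance_def Compl_eq_Diff_UNIV[symmetric] fibre_simps
      by (rule arg_cong[where f = udensity]) auto
    then show "UNIV - E \<in> balanced" using E by (simp add: balanced_def)
    fix F assume F: "F \<in> balanced"
    have "(\<lambda>n. imbalance n E + imbalance n F) \<longlonglongrightarrow> 0"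
      using tendsto_add[of "\<lambda>n. imbalance n E" 0 _ "\<lambda>n. imbalance n F" 0] E F by (simp add: balanced_def)
    then have "(\<lambda>n. imbalance n (E \<union> F)) \<longlonglongrightarrow> 0"
      by (rule Lim_null_comparison[rotated]) (simp add: imbalance_nonneg imbalance_Un)
    then show "E \<union> F \<in> balanced" by (simp add: balanced_def)
  qed auto
  then show "set_algebra balanced" by (simp add: set_algebra_def)
qed

definition thin :: "real \<Rightarrow> nat set \<Rightarrow> bool" where
  "thin \<delta> E \<longleftrightarrow> (\<forall>b n. udensity (fibre b n E) \<le> \<delta>)"

lemma thin_mono: "E \<subseteq> F \<Longrightarrow> thin \<delta> F \<Longrightarrow> thin \<delta> E"
  unfolding thin_def using udensity.mono[OF UNIV_I UNIV_I fibre_mono] by (meson order_trans)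

lemma thin_Un: "thin \<delta> E \<Longrightarrow> thin \<epsilon> F \<Longrightarrow> thin (\<delta> + \<epsilon>) (E \<union> F)"
  unfolding thin_def fibre_simps using udensity.subadd[OF UNIV_I UNIV_I] by (meson add_mono order_trans)

text \<open>
  Splitting both copies of each fibre along the same residue classes modulo \<open>m\<close> gives a
  partition of the natural numbers into finitely many balanced sets of density at most \<open>1/m\<close> in all fibres.
\<close>

lemma thin_nbhd:
  assumes p: "p \<in> balanced.points" and "0 < \<delta>"
  obtains E where "E \<in> balanced" "p \<in> balanced.clop E" "thin \<delta> E"
proof -
  obtain m where m: "0 < m" "1 / real m < \<delta>"
    using nat_approx_posE[OF \<open>0 < \<delta>\<close>] by (metis zero_less_Suc)
  define R where "R r = {x. (snd (prod_decode x) div 2) mod m = r}" for r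
  have fibR: "fibre b n (R r) = {y. y mod m = r}" for b n r
    by (auto simp: fibre_def R_def)
  have bal: "R r \<in> balanced" for r
    by (simp add: balanced_def imbalance_def fibR udensity.empty)
  have "(\<Union>r\<in>{..<m}. R r) = UNIV" using m by (auto simp: R_def)
  then have "(\<Union>r\<in>{..<m}. balanced.clop (R r)) = balanced.points"
    using balanced.clop_finite_UN[of "{..<m}" R] bal balanced.clop_UNIV by simp
  then obtain r where r: "p \<in> balanced.clop (R r)" using p by blast
  have "udensity {y. y mod m = r} \<le> \<delta>" using udensity_residue[OF m(1), of r] m(2) by linarith
  then have "thin \<delta> (R r)" by (simp add: thin_def fibR)
  with bal r show thesis by (rule that)
qed

section \<open>An uncountable almost disjoint family\<close>

text \<open>
  Nodes of the binary tree, coded by natural numbers: different branches share finitely many nodes only.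
\<close>

definition branch :: "(nat \<Rightarrow> bool) \<Rightarrow> nat set" where
  "branch \<xi> = range (\<lambda>n. to_nat (map \<xi> [0..<n]))"

lemma infinite_branch: "infinite (branch \<xi>)"
  unfolding branch_def
proof (rule range_inj_infinite, rule injI)
  fix m n assume "to_nat (map \<xi> [0..<m]) = to_nat (map \<xi> [0..<n])"
  then have "length (map \<xi> [0..<m]) = length (map \<xi> [0..<n])" by simp
  then show "m = n" by simp
qed

lemma finite_branch_Int:
  assumes "\<xi> \<noteq> \<zeta>" shows "finite (branch \<xi> \<inter> branch \<zeta>)"
proof -
  obtain i where i: "\<xi> i \<noteq> \<zeta> i" using assms by auto
  have "branch \<xi> \<inter> branch \<zeta> \<subseteq> (\<lambda>n. to_nat (map \<xi> [0..<n])) ` {..i}"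
  proof
    fix x assume "x \<in> branch \<xi> \<inter> branch \<zeta>"
    then obtain m n where x: "x = to_nat (map \<xi> [0..<m])" "x = to_nat (map \<zeta> [0..<n])"
      unfolding branch_def by blast
    then have eq: "map \<xi> [0..<m] = map \<zeta> [0..<n]" by simp
    then have mn: "m = n" using map_eq_imp_length_eq by fastforce
    have "m \<le> i"
    proof (rule ccontr)
      assume "\<not> m \<le> i"
      then have "map \<xi> [0..<m] ! i = \<xi> i" "map \<zeta> [0..<n] ! i = \<zeta> i" using mn by simp_all
      with eq i show False by simp
    qed
    then show "x \<in> (\<lambda>n. to_nat (map \<xi> [0..<n])) ` {..i}" using x by auto
  qed
  then show ?thesis by (rule finite_subset) simp
qed

lemma uncountable_bool_seq: "uncountable (UNIV :: (nat \<Rightarrow> bool) set)"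
proof
  assume "countable (UNIV :: (nat \<Rightarrow> bool) set)"
  then have *: "range (from_nat_into (UNIV :: (nat \<Rightarrow> bool) set)) = UNIV"
    by (intro range_from_nat_into) auto
  define d where "d n = (\<not> from_nat_into UNIV n n)" for n
  obtain k where "d = from_nat_into UNIV k" using * by (metis UNIV_I imageE)
  then have "d k = from_nat_into UNIV k k" by simp
  then show False by (simp add: d_def)
qed

section \<open>Unions of thin balanced sets\<close>

text \<open>
  The sets listed are the branches along which the unions of the tails keep positive density. For two
  different branches, sufficiently late tails are disjoint; so for a given \<open>\<delta>\<close> at most \<open>1/\<delta>\<close> branches are
  possible, the total density being \<open>1\<close>.
\<close>

lemma countable_excess:
  fixes a :: "nat \<Rightarrow> nat set"
  assumes dis: "disjoint_family a"
  shows "countable {\<xi>. \<exists>\<delta>>0. \<forall>N. \<delta> \<le> udensity (fibre b n (\<Union>k\<in>branch \<xi> \<inter> {N..}. a k))}"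
    (is "countable ?X")
proof -
  define T where "T \<xi> N = (\<Union>k\<in>branch \<xi> \<inter> {N..}. a k)" for \<xi> N
  define Y where "Y i = {\<xi>. \<forall>N. 1 / real (Suc i) \<le> udensity (fibre b n (T \<xi> N))}" for i
  have fin: "finite (Y i)" for i
  proof (rule ccontr)
    assume "infinite (Y i)"
    then obtain F where F: "F \<subseteq> Y i" "finite F" "card F = i + 2"
      using infinite_arbitrarily_large by blast
    have "finite (\<Union>\<xi>\<in>F. \<Union>\<zeta>\<in>F - {\<xi>}. branch \<xi> \<inter> branch \<zeta>)"
      using F finite_branch_Int by (intro finite_UN_I finite_Diff) auto
    then obtain N where N: "(\<Union>\<xi>\<in>F. \<Union>\<zeta>\<in>F - {\<xi>}. branch \<xi> \<inter> branch \<zeta>) \<subseteq> {..<N}"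
      using finite_nat_iff_bounded by blast
    have "disjoint_family_on (\<lambda>\<xi>. fibre b n (T \<xi> N)) F"
      unfolding disjoint_family_on_def
    proof (intro ballI impI)
      fix \<xi> \<zeta> assume *: "\<xi> \<in> F" "\<zeta> \<in> F" "\<xi> \<noteq> \<zeta>"
      have "T \<xi> N \<inter> T \<zeta> N = {}"
      proof (rule ccontr)
        assume "T \<xi> N \<inter> T \<zeta> N \<noteq> {}"
        then obtain x k l where x: "k \<in> branch \<xi>" "N \<le> k" "x \<in> a k" "l \<in> branch \<zeta>" "x \<in> a l"
          by (auto simp: T_def)
        then have "k = l" using dis by (auto simp: disjoint_family_on_def)
        with x N * show False by fastforce
      qed
      then show "fibre b n (T \<xi> N) \<inter> fibre b n (T \<zeta> N) = {}"
        by (simp flip: fibre_simps(4)) (simp add: fibre_simps)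
    qed
    then have "udensity (\<Union>\<xi>\<in>F. fibre b n (T \<xi> N)) = (\<Sum>\<xi>\<in>F. udensity (fibre b n (T \<xi> N)))"
      using F by (intro udensity.sum_disjoint) auto
    also have "\<dots> \<ge> (\<Sum>\<xi>\<in>F. 1 / real (Suc i))"
      using F by (intro sum_mono) (auto simp: Y_def)
    finally have "real (i + 2) / real (Suc i) \<le> udensity (\<Union>\<xi>\<in>F. fibre b n (T \<xi> N))"
      using F by simp
    also have "\<dots> \<le> 1" using udensity.mono[of _ UNIV] udensity_UNIV by simp
    finally show False by (simp add: divide_le_eq)
  qed
  have "?X \<subseteq> (\<Union>i. Y i)"
  proof
    fix \<xi> assume "\<xi> \<in> ?X"
    then obtain \<delta> where pos: "0 < \<delta>" and \<delta>: "\<And>N. \<delta> \<le> udensity (fibre b n (T \<xi> N))"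
      by (auto simp: T_def)
    obtain i where "1 / real (Suc i) < \<delta>" using pos by (rule nat_approx_posE)
    with \<delta> have "\<xi> \<in> Y i" unfolding Y_def by (auto intro: less_imp_le less_le_trans)
    then show "\<xi> \<in> (\<Union>i. Y i)" by blast
  qed
  then show ?thesis by (rule countable_subset) (auto intro: countable_finite fin)
qed

text \<open>
  If the density of the tails of the union tends to \<open>0\<close>, then it is bounded by the sum of the densities, a
  geometric tail which is uniform over all fibres. Up to this uniformly small error the union is a finite
  union of balanced sets.
\<close>

lemma balanced_thin_union:
  assumes bal: "\<And>k. a k \<in> balanced" and thin: "\<And>k. thin ((1/2)^k) (a k)"
    and excess: "\<And>b n \<delta>. 0 < \<delta> \<Longrightarrow> \<exists>N. udensity (fibre b n (\<Union>k\<in>M \<inter> {N..}. a k)) < \<delta>"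
  shows "(\<Union>k\<in>M. a k) \<in> balanced"
proof -
  define T where "T N = (\<Union>k\<in>M \<inter> {N..}. a k)" for N
  define I where "I N = (\<Union>k\<in>M \<inter> {..<N}. a k)" for N
  have Tle: "udensity (fibre b n (T N)) \<le> 2 * (1/2)^N" for b n N
  proof (rule field_le_epsilon)
    fix \<delta> :: real assume "0 < \<delta>"
    then obtain N' where N': "udensity (fibre b n (T N')) < \<delta>" using excess unfolding T_def by blast
    let ?J = "M \<inter> {N..<N'}"
    have "M \<inter> {N..} \<subseteq> ?J \<union> (M \<inter> {N'..})" by auto
    then have "T N \<subseteq> (\<Union>k\<in>?J. a k) \<union> T N'" unfolding T_def by blast
    then have "udensity (fibre b n (T N)) \<le> udensity (fibre b n ((\<Union>k\<in>?J. a k) \<union> T N'))"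
      by (intro udensity.mono fibre_mono) auto
    also have "\<dots> \<le> udensity (\<Union>k\<in>?J. fibre b n (a k)) + udensity (fibre b n (T N'))"
      unfolding fibre_simps by (rule udensity.subadd) auto
    also have "udensity (\<Union>k\<in>?J. fibre b n (a k)) \<le> (\<Sum>k\<in>?J. udensity (fibre b n (a k)))"
      by (rule udensity.subadd_finite) auto
    also have "\<dots> \<le> (\<Sum>k\<in>?J. (1/2)^k)" using thin by (intro sum_mono) (auto simp: thin_def)
    also have "\<dots> \<le> (\<Sum>k\<in>{N..<N'}. (1/2)^k)" by (intro sum_mono2) auto
    also have "\<dots> \<le> 2 * (1/2)^N"
    proof (cases "N \<le> N'")
      case True
      have "(\<Sum>k\<in>{N..<N + j}. (1/2::real)^k) = 2 * (1/2)^N - 2 * (1/2)^(N+j)" for j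
        by (induction j) auto
      from this[of "N' - N"] True show ?thesis by simp
    qed simp
    finally show "udensity (fibre b n (T N)) \<le> 2 * (1/2)^N + \<delta>" using N' by simp
  qed
  have Ibal: "I N \<in> balanced" for N
    unfolding I_def using bal by (intro balanced.finite_UN) auto
  have le: "imbalance n (\<Union>k\<in>M. a k) \<le> imbalance n (I N) + 4 * (1/2)^N" for n N
  proof -
    have "M = (M \<inter> {..<N}) \<union> (M \<inter> {N..})" by auto
    then have "(\<Union>k\<in>M. a k) = I N \<union> T N" unfolding I_def T_def by blast
    then have "imbalance n (\<Union>k\<in>M. a k) \<le> imbalance n (I N) + imbalance n (T N)" using imbalance_Un by simp
    also have "imbalance n (T N) \<le> 4 * (1/2)^N" using imbalance_le[of n "T N"] Tle[of False n N] Tle[of True n N] by simp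
    finally show ?thesis by simp
  qed
  have "(\<lambda>n. imbalance n (\<Union>k\<in>M. a k)) \<longlonglongrightarrow> 0"
  proof (rule LIMSEQ_I)
    fix r :: real assume r: "0 < r"
    then obtain N where N: "(1/2)^N < r/8" using real_arch_pow_inv[of "r/8" "1/2"] by auto
    have "(\<lambda>n. imbalance n (I N)) \<longlonglongrightarrow> 0" using Ibal by (simp add: balanced_def)
    then obtain n0 where n0: "\<And>n. n \<ge> n0 \<Longrightarrow> norm (imbalance n (I N) - 0) < r/2"
      using LIMSEQ_D[of _ 0 "r/2"] r by (metis half_gt_zero)
    have "norm (imbalance n (\<Union>k\<in>M. a k) - 0) < r" if "n \<ge> n0" for n
      using le[of n N] n0[OF that] N imbalance_nonneg[of n "\<Union>k\<in>M. a k"] by simp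
    then show "\<exists>n0. \<forall>n\<ge>n0. norm (imbalance n (\<Union>k\<in>M. a k) - 0) < r" by blast
  qed
  then show ?thesis by (simp add: balanced_def)
qed

text \<open>
  Only countably many branches fail to give a balanced union. Among the others, a given point \<open>x\<close>
  can lie in the clopen set of the union without lying in that of any \<open>a k\<close> for at most one branch: if
  this happened for two, \<open>x\<close> would lie in the clopen set of the intersection of the two unions, which is a
  finite union of sets \<open>a k\<close>. Uncountably many branches remain.
\<close>

lemma thin_union_selection:
  fixes a :: "nat \<Rightarrow> nat set"
  assumes bal: "\<And>k. a k \<in> balanced" and dis: "disjoint_family a"
    and thin: "\<And>k. thin ((1/2)^k) (a k)" and D: "countable D" "D \<subseteq> balanced.points"
  obtains M where "infinite M" "(\<Union>k\<in>M. a k) \<in> balanced"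
    "balanced.clop (\<Union>k\<in>M. a k) \<inter> D = (\<Union>k\<in>M. balanced.clop (a k)) \<inter> D"
proof -
  define u where "u \<xi> = (\<Union>k\<in>branch \<xi>. a k)" for \<xi>
  define X where "X = (\<Union>b. \<Union>n. {\<xi>. \<exists>\<delta>>0. \<forall>N. \<delta> \<le> udensity (fibre b n (\<Union>k\<in>branch \<xi> \<inter> {N..}. a k))})"
  have cX: "countable X" unfolding X_def by (intro countable_UN countable_excess[OF dis]) auto
  have good: "u \<xi> \<in> balanced" if "\<xi> \<notin> X" for \<xi>
    unfolding u_def
  proof (rule balanced_thin_union[OF bal thin])
    fix b n and \<delta> :: real assume "0 < \<delta>"
    with that show "\<exists>N. udensity (fibre b n (\<Union>k\<in>branch \<xi> \<inter> {N..}. a k)) < \<delta>"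
      unfolding X_def by (auto simp: not_le)
  qed
  define Z where "Z x = {\<xi>. \<xi> \<notin> X \<and> x \<in> balanced.clop (u \<xi>) \<and> (\<forall>k\<in>branch \<xi>. x \<notin> balanced.clop (a k))}" for x
  have uniq: "\<xi> = \<zeta>" if "\<xi> \<in> Z x" "\<zeta> \<in> Z x" for \<xi> \<zeta> x
  proof (rule ccontr)
    assume ne: "\<xi> \<noteq> \<zeta>"
    have "u \<xi> \<inter> u \<zeta> = (\<Union>k\<in>branch \<xi> \<inter> branch \<zeta>. a k)"
    proof (intro subset_antisym subsetI)
      fix x assume "x \<in> u \<xi> \<inter> u \<zeta>"
      then obtain k l where kl: "k \<in> branch \<xi>" "x \<in> a k" "l \<in> branch \<zeta>" "x \<in> a l"
        by (auto simp: u_def)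
      then have "k = l" using dis by (auto simp: disjoint_family_on_def)
      with kl show "x \<in> (\<Union>k\<in>branch \<xi> \<inter> branch \<zeta>. a k)" by auto
    qed (auto simp: u_def)
    then have "balanced.clop (u \<xi>) \<inter> balanced.clop (u \<zeta>) = (\<Union>k\<in>branch \<xi> \<inter> branch \<zeta>. balanced.clop (a k))"
      using balanced.clop_Int[of "u \<xi>" "u \<zeta>"] good that
        balanced.clop_finite_UN[OF finite_branch_Int[OF ne], of a] bal
      by (simp add: Z_def)
    with that show False by (auto simp: Z_def)
  qed
  have "countable (Z x)" for x
  proof (cases "Z x = {}")
    case False
    then obtain \<xi> where "\<xi> \<in> Z x" by blast
    then have "Z x \<subseteq> {\<xi>}" using uniq[of \<xi> x] by blast
    then show ?thesis by (rule countable_subset) simp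
  qed simp
  then have "countable (X \<union> (\<Union>x\<in>D. Z x))" using cX D by auto
  then have "X \<union> (\<Union>x\<in>D. Z x) \<noteq> UNIV" using uncountable_bool_seq by metis
  then obtain \<xi> where "\<xi> \<notin> X \<union> (\<Union>x\<in>D. Z x)" by blast
  then have \<xi>: "\<xi> \<notin> X" "\<And>x. x \<in> D \<Longrightarrow> \<xi> \<notin> Z x" by auto
  have "balanced.clop (a k) \<subseteq> balanced.clop (u \<xi>)" if "k \<in> branch \<xi>" for k
    using that bal good[OF \<xi>(1)] by (subst balanced.clop_subset_iff) (auto simp: u_def)
  then have "balanced.clop (u \<xi>) \<inter> D = (\<Union>k\<in>branch \<xi>. balanced.clop (a k)) \<inter> D"
    using \<xi> by (auto simp: Z_def)
  with infinite_branch[of \<xi>] good[OF \<xi>(1)] show thesis unfolding u_def by (rule that)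
qed

interpretation thin_sets: small_union_algebra balanced.points "balanced.clop ` balanced"
  "\<lambda>\<delta> c. \<exists>E\<in>balanced. c = balanced.clop E \<and> thin \<delta> E"
proof (intro small_union_algebra.intro small_union_algebra_axioms.intro)
  show "algebra balanced.points (balanced.clop ` balanced)" by (rule balanced.algebra_clop)
next
  fix p q assume "p \<in> balanced.points" "q \<in> balanced.points" "p \<noteq> q"
  then obtain E where "E \<in> balanced" "p \<in> balanced.clop E" "q \<notin> balanced.clop E"
    by (rule balanced.separate_points)
  then show "\<exists>c\<in>balanced.clop ` balanced. p \<in> c \<and> q \<notin> c" by auto
next
  fix \<delta> :: real assume "0 < \<delta>"
  then have "thin \<delta> {}" by (simp add: thin_def fibre_simps udensity.empty)
  then show "\<exists>E\<in>balanced. {} = balanced.clop E \<and> thin \<delta> E"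
    using balanced.clop_empty by (intro bexI[of _ "{}"]) auto
next
  fix c d and \<delta> :: real
  assume "c \<in> balanced.clop ` balanced" "d \<in> balanced.clop ` balanced" "c \<subseteq> d"
    "\<exists>E\<in>balanced. d = balanced.clop E \<and> thin \<delta> E"
  then obtain E F where *: "E \<in> balanced" "F \<in> balanced" "c = balanced.clop E" "d = balanced.clop F" "thin \<delta> F"
    by auto
  then have "E \<subseteq> F" using \<open>c \<subseteq> d\<close> balanced.clop_subset_iff by simp
  then show "\<exists>E\<in>balanced. c = balanced.clop E \<and> thin \<delta> E" using * thin_mono by blast
next
  fix c d and \<delta> \<epsilon> :: real
  assume "\<exists>E\<in>balanced. c = balanced.clop E \<and> thin \<delta> E" "\<exists>E\<in>balanced. d = balanced.clop E \<and> thin \<epsilon> E"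
  then obtain E F where *: "E \<in> balanced" "F \<in> balanced" "c = balanced.clop E" "thin \<delta> E"
    "d = balanced.clop F" "thin \<epsilon> F" by auto
  then show "\<exists>E\<in>balanced. c \<union> d = balanced.clop E \<and> thin (\<delta> + \<epsilon>) E"
    by (intro bexI[of _ "E \<union> F"]) (auto simp: balanced.clop_Un thin_Un)
next
  fix p and \<delta> :: real assume "p \<in> balanced.points" "0 < \<delta>"
  then obtain E where "E \<in> balanced" "p \<in> balanced.clop E" "thin \<delta> E" by (rule thin_nbhd)
  then show "\<exists>c\<in>balanced.clop ` balanced. p \<in> c \<and> (\<exists>E\<in>balanced. c = balanced.clop E \<and> thin \<delta> E)"
    by auto
next
  fix c :: "nat \<Rightarrow> nat set set set" and D
  assume dis: "disjoint_family c" and D: "countable D" "D \<subseteq> balanced.points"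
    and "\<And>k. \<exists>E\<in>balanced. c k = balanced.clop E \<and> thin ((1/2)^k) E"
  then obtain a where a: "\<And>k. a k \<in> balanced" "\<And>k. c k = balanced.clop (a k)" "\<And>k. thin ((1/2)^k) (a k)"
    by metis
  have "disjoint_family a"
    unfolding disjoint_family_on_def
  proof (intro ballI impI)
    fix m n :: nat assume "m \<noteq> n"
    then have "balanced.clop (a m \<inter> a n) \<subseteq> balanced.clop {}"
      using dis a by (auto simp: balanced.clop_Int disjoint_family_on_def)
    then show "a m \<inter> a n = {}" using a balanced.clop_subset_iff[of "a m \<inter> a n" "{}"] by auto
  qed
  from thin_union_selection[OF a(1) this a(3) D]
  obtain M where M: "infinite M" "(\<Union>k\<in>M. a k) \<in> balanced"
    "balanced.clop (\<Union>k\<in>M. a k) \<inter> D = (\<Union>k\<in>M. balanced.clop (a k)) \<inter> D" by blast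
  then show "\<exists>M d. infinite M \<and> d \<in> balanced.clop ` balanced \<and> d \<inter> D = (\<Union>k\<in>M. c k) \<inter> D"
    using a(2) by (intro exI[of _ M] exI[of _ "balanced.clop (\<Union>k\<in>M. a k)"]) auto
qed

section \<open>Atomic measures on the Stone space of the balanced sets\<close>

text \<open>
  Indicators of clopen sets are continuous, so weak* convergence gives convergence on clopen sets. This
  yields norm convergence of the coefficients, hence convergence on every Borel set to an atomic measure.
\<close>

theorem balanced_l1_grothendieck: "l1_grothendieck_property balanced.stone"
  unfolding l1_grothendieck_property_def
proof (intro allI impI)
  let ?L = balanced.stone
  fix \<mu>s assume l1: "\<forall>n. l1_measure ?L (\<mu>s n)" and ws: "weakstar_convergent ?L \<mu>s"
  have H: "Hausdorff_space ?L" by (rule balanced.Hausdorff_stone)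
  have "\<forall>n. \<exists>\<alpha>. (\<lambda>x. \<bar>\<alpha> x\<bar>) summable_on topspace ?L \<and>
        (\<forall>B\<in>borel_sets_of ?L. \<mu>s n B = (\<Sum>\<^sub>\<infinity>x\<in>topspace ?L. \<alpha> x * indicator B x))"
    using l1 by (auto simp: l1_measure_def)
  from choice[OF this] obtain \<alpha> where \<alpha>: "\<forall>n. (\<lambda>x. \<bar>\<alpha> n x\<bar>) summable_on topspace ?L \<and>
      (\<forall>B\<in>borel_sets_of ?L. \<mu>s n B = (\<Sum>\<^sub>\<infinity>x\<in>topspace ?L. \<alpha> n x * indicator B x))" ..
  have abs: "(\<lambda>x. \<bar>\<alpha> n x\<bar>) summable_on topspace ?L" for n
    by (rule conjunct1[OF spec[OF \<alpha>]])
  have eq: "\<mu>s n B = (\<Sum>\<^sub>\<infinity>x\<in>topspace ?L. \<alpha> n x * indicator B x)" if "B \<in> borel_sets_of ?L" for n B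
    by (rule bspec[OF conjunct2[OF spec[OF \<alpha>]] that])
  have sm: "\<alpha> n summable_on topspace ?L" for n
    using abs[of n] summable_on_iff_abs_summable_on_real[of "\<alpha> n" "topspace ?L"] by simp
  have \<mu>: "\<mu>s n B = infsum (\<alpha> n) B" if "B \<in> borel_sets_of ?L" for n B
    using eq[OF that] infsum_indicator[OF borel_sets_of_subset[OF that]] by simp
  have "convergent (\<lambda>n. infsum (\<alpha> n) c)" if cl: "c \<in> balanced.clop ` balanced" for c
  proof -
    obtain E where E: "E \<in> balanced" "c = balanced.clop E" using cl by auto
    have c: "c \<in> borel_sets_of ?L" using E balanced.clop_borel by simp
    have "signed_integral ?L (\<mu>s n) (indicator c) = infsum (\<alpha> n) c" for n
      using hahn_pair.signed_integral_indicator[OF l1_hahn_pair[OF H sm \<mu>] c] \<mu>[OF c] by simp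
    moreover have "convergent (\<lambda>n. signed_integral ?L (\<mu>s n) (indicator c))"
      using ws E balanced.continuous_indicator_clop
      by (auto simp: weakstar_convergent_def weakstar_convergent_to_def convergent_def)
    ultimately show ?thesis by simp
  qed
  then obtain a where a: "a summable_on topspace ?L"
    and lim: "(\<lambda>n. mass (\<lambda>x. \<alpha> n x - a x) (topspace ?L)) \<longlonglongrightarrow> 0"
    using thin_sets.setwise_convergent_imp_norm_convergent[of \<alpha>] sm unfolding balanced.topspace_stone by blast
  have "weakly_convergent_to ?L \<mu>s (infsum a)"
    unfolding weakly_convergent_to_def
  proof
    fix B assume B: "B \<in> borel_sets_of ?L"
    then have Bs: "B \<subseteq> topspace ?L" by (rule borel_sets_of_subset)
    have bound: "norm (\<mu>s n B - infsum a B) \<le> mass (\<lambda>x. \<alpha> n x - a x) (topspace ?L)" for n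
    proof -
      have d: "(\<lambda>x. \<alpha> n x - a x) summable_on topspace ?L" by (rule summable_on_diff[OF sm a])
      have "\<mu>s n B - infsum a B = infsum (\<lambda>x. \<alpha> n x - a x) B"
        using infsum_diff[OF l1_summable[OF sm Bs] l1_summable[OF a Bs]] \<mu>[OF B] by simp
      then show ?thesis
        using abs_infsum_le_mass[OF d Bs] mass_mono[OF d Bs order_refl] by simp
    qed
    have "(\<lambda>n. \<mu>s n B - infsum a B) \<longlonglongrightarrow> 0"
      by (rule Lim_null_comparison[OF always_eventually lim]) (rule allI, rule bound)
    then show "(\<lambda>n. \<mu>s n B) \<longlonglongrightarrow> infsum a B" by (rule LIM_zero_cancel)
  qed
  moreover have "radon_measure ?L (infsum a)" by (rule l1_radon_measure[OF H a]) simp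
  ultimately show "weakly_convergent ?L \<mu>s" by (auto simp: weakly_convergent_def)
qed

section \<open>Failure of the Grothendieck property\<close>

interpretation fibre_content: content_on_algebra balanced "\<lambda>E. udensity (fibre b n E)" for b n
proof (intro content_on_algebra.intro content_on_algebra_axioms.intro)
  show "set_algebra balanced" by (rule balanced.set_algebra_axioms)
  show "0 \<le> udensity (fibre b n E)" for E by (rule udensity_nonneg)
  fix E F :: "nat set" assume "E \<inter> F = {}"
  then have "fibre b n E \<inter> fibre b n F = {}" by (auto simp: fibre_def)
  then show "udensity (fibre b n (E \<union> F)) = udensity (fibre b n E) + udensity (fibre b n F)"
    unfolding fibre_simps by (rule udensity_Un)
qed

text \<open>
  Copy \<open>b\<close> of fibre \<open>n\<close>. It is balanced although its two traces on fibre \<open>n\<close> are as different as possible,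
  because balance concerns the limit over the fibres.
\<close>

definition half :: "bool \<Rightarrow> nat \<Rightarrow> nat set" where
  "half b n = range (\<lambda>y. prod_encode (n, 2 * y + of_bool b))"

lemma fibre_half: "fibre b' n' (half b n) = (if b' = b \<and> n' = n then UNIV else {})"
proof -
  have "2 * x + of_bool b' = 2 * y + of_bool b \<longleftrightarrow> x = y \<and> b' = b" for x y :: nat
    by (cases b; cases b') (auto, presburger+)
  then show ?thesis by (auto simp: fibre_def half_def prod_encode_eq)
qed

lemma half_balanced: "half b n \<in> balanced"
proof -
  have "eventually (\<lambda>n'. imbalance n' (half b n) = 0) sequentially"
    using eventually_gt_at_top[of n] by eventually_elim (simp add: imbalance_def fibre_half udensity.empty)
  then show ?thesis unfolding balanced_def by (auto intro: tendsto_eventually)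
qed

abbreviation fibre_measure :: "bool \<Rightarrow> nat \<Rightarrow> nat set set measure" where
  "fibre_measure b n \<equiv> content_on_algebra.ext balanced (\<lambda>E. udensity (fibre b n E))"

definition fibre_difference :: "nat \<Rightarrow> nat set set set \<Rightarrow> real" where
  "fibre_difference n B = measure (fibre_measure False n) B - measure (fibre_measure True n) B"

interpretation fibre_pair: hahn_pair "fibre_measure False n" "fibre_measure True n" balanced.stone
  "balanced.clop (half False n)" "fibre_difference n" for n
proof (intro hahn_pair.intro hahn_pair_axioms.intro)
  show "finite_measure (fibre_measure False n)" "finite_measure (fibre_measure True n)"
    by (rule fibre_content.finite_ext)+
  show "sets (fibre_measure False n) = borel_sets_of balanced.stone"
    "sets (fibre_measure True n) = borel_sets_of balanced.stone" by (rule fibre_content.sets_ext)+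
  show "balanced.clop (half False n) \<in> borel_sets_of balanced.stone"
    by (rule balanced.clop_borel[OF half_balanced])
  show "measure (fibre_measure True n) (balanced.clop (half False n)) = 0"
    by (simp add: fibre_content.measure_ext_clop half_balanced fibre_half udensity.empty)
  have "topspace balanced.stone - balanced.clop (half False n) = balanced.clop (- half False n)"
    by (simp add: balanced.topspace_stone balanced.clop_Compl half_balanced)
  then show "measure (fibre_measure False n) (topspace balanced.stone - balanced.clop (half False n)) = 0"
    by (simp add: fibre_content.measure_ext_clop half_balanced balanced.Compl_in fibre_half fibre_simps udensity.empty)
qed (simp add: fibre_difference_def)

lemma radon_fibre_difference: "radon_measure balanced.stone (fibre_difference n)"
  by (rule fibre_pair.radon_measureI)
    (auto intro: compactin_imp_closedin[OF balanced.Hausdorff_stone] fibre_content.inner_regular_ext)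

lemma fibre_difference_clop: "E \<in> balanced \<Longrightarrow> \<bar>fibre_difference n (balanced.clop E)\<bar> \<le> imbalance n E"
proof -
  assume E: "E \<in> balanced"
  have "udensity X \<le> udensity (sym_diff X Y) + udensity Y" for X Y
    by (rule order_trans[OF udensity.mono[of _ "sym_diff X Y \<union> Y"] udensity.subadd]) auto
  from this[of "fibre False n E" "fibre True n E"] this[of "fibre True n E" "fibre False n E"]
  show ?thesis using E by (simp add: fibre_difference_def fibre_content.measure_ext_clop imbalance_def Un_commute abs_le_iff)
qed

text \<open>
  By \<open>fibre_difference_clop\<close> the measures tend to \<open>0\<close> on clopen sets. Since they have norm at most \<open>2\<close>,
  uniform approximation by clopen step functions carries this over to continuous functions.
\<close>

lemma fibre_difference_weakstar_null:
  "weakstar_convergent_to balanced.stone fibre_difference (\<lambda>B. 0)"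
  unfolding weakstar_convergent_to_def signed_integral_zero[OF balanced.Hausdorff_stone]
proof (intro allI impI)
  fix f assume f: "continuous_map balanced.stone euclideanreal f"
  show "(\<lambda>n. signed_integral balanced.stone (fibre_difference n) f) \<longlonglongrightarrow> 0"
  proof (rule LIMSEQ_I)
    fix r :: real assume r: "0 < r"
    obtain I c where I: "finite I" "\<And>v. v \<in> I \<Longrightarrow> c v \<in> balanced"
      and approx: "\<And>p. p \<in> balanced.points \<Longrightarrow>
        \<bar>f p - (\<Sum>v\<in>I. v * indicator (balanced.clop (c v)) p)\<bar> < r/4"
      using balanced.clop_step_approximation[OF f, of "r/4"] r by auto
    define s where "s n = (\<Sum>v\<in>I. v * fibre_difference n (balanced.clop (c v)))" for n
    have mass1: "measure (fibre_measure b n) balanced.points = 1" for b n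
      using fibre_content.measure_ext_clop[of UNIV b n] by (simp add: balanced.clop_UNIV fibre_simps udensity_UNIV)
    have one: "\<bar>(LINT p|fibre_measure b n. f p) -
        (\<Sum>v\<in>I. v * measure (fibre_measure b n) (balanced.clop (c v)))\<bar> \<le> r/4" for b n
      using balanced.integral_clop_step[OF fibre_content.finite_ext fibre_content.sets_ext fibre_content.space_ext f I approx]
      by (simp add: mass1)
    have close: "\<bar>signed_integral balanced.stone (fibre_difference n) f - s n\<bar> \<le> r/2" for n
    proof -
      have "s n = (\<Sum>v\<in>I. v * measure (fibre_measure False n) (balanced.clop (c v))) -
        (\<Sum>v\<in>I. v * measure (fibre_measure True n) (balanced.clop (c v)))"
        by (simp add: s_def fibre_difference_def right_diff_distrib sum_subtractf)
      then show ?thesis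
        using one[of False n] one[of True n] unfolding fibre_pair.signed_integral_eq by linarith
    qed
    have "(\<lambda>n. fibre_difference n (balanced.clop (c v))) \<longlonglongrightarrow> 0" if "v \<in> I" for v
    proof (rule Lim_null_comparison)
      show "(\<lambda>n. imbalance n (c v)) \<longlonglongrightarrow> 0" using I(2)[OF that] by (simp add: balanced_def)
      show "eventually (\<lambda>n. norm (fibre_difference n (balanced.clop (c v))) \<le> imbalance n (c v)) sequentially"
        using fibre_difference_clop[OF I(2)[OF that]] by simp
    qed
    then have "s \<longlonglongrightarrow> (\<Sum>v\<in>I. v * 0)"
      unfolding s_def by (intro tendsto_sum tendsto_mult tendsto_const)
    then obtain n0 where n0: "\<And>n. n0 \<le> n \<Longrightarrow> norm (s n - 0) < r/2"
      using LIMSEQ_D[of s 0 "r/2"] r by auto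
    have "norm (signed_integral balanced.stone (fibre_difference n) f - 0) < r" if "n0 \<le> n" for n
      using close[of n] n0[OF that] unfolding real_norm_def diff_zero by linarith
    then show "\<exists>n0. \<forall>n\<ge>n0. norm (signed_integral balanced.stone (fibre_difference n) f - 0) < r" by blast
  qed
qed

text \<open>
  The disjoint open sets \<open>h i\<close> separate the measures: countable additivity of the weak limit is violated on their
  union.
\<close>

theorem balanced_not_grothendieck: "\<not> grothendieck_property balanced.stone"
proof
  assume "grothendieck_property balanced.stone"
  moreover have "weakstar_convergent balanced.stone fibre_difference"
    using fibre_difference_weakstar_null zero_radon_measure[OF balanced.Hausdorff_stone]
    by (auto simp: weakstar_convergent_def)
  ultimately obtain \<nu> where \<nu>: "radon_measure balanced.stone \<nu>"
    and lim: "\<And>B. B \<in> borel_sets_of balanced.stone \<Longrightarrow> (\<lambda>n. fibre_difference n B) \<longlonglongrightarrow> \<nu> B"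
    using radon_fibre_difference
    unfolding grothendieck_property_def weakly_convergent_def weakly_convergent_to_def by blast
  define h where "h i = balanced.clop (half False i)" for i
  have hb: "range h \<subseteq> borel_sets_of balanced.stone"
    by (auto simp: h_def intro: balanced.clop_borel half_balanced)
  have hd: "disjoint_family h"
    unfolding disjoint_family_on_def
  proof (intro ballI impI)
    fix m n :: nat assume "m \<noteq> n"
    then have "half False m \<inter> half False n = {}" by (auto simp: half_def prod_encode_eq)
    then show "h m \<inter> h n = {}"
      using balanced.clop_Int[OF half_balanced half_balanced, of False m False n] balanced.clop_empty
      by (simp add: h_def)
  qed
  have val: "fibre_difference n (h i) = (if i = n then 1 else 0)" for n i
    by (simp add: h_def fibre_difference_def fibre_content.measure_ext_clop half_balanced fibre_half
        udensity_UNIV udensity.empty)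
  have "\<nu> (h i) = 0" for i
  proof (rule LIMSEQ_unique[OF lim])
    show "h i \<in> borel_sets_of balanced.stone" using hb by auto
    show "(\<lambda>n. fibre_difference n (h i)) \<longlonglongrightarrow> 0"
      by (rule tendsto_eventually)
        (use eventually_gt_at_top[of i] in \<open>eventually_elim, simp add: val\<close>)
  qed
  moreover have "signed_borel_measure balanced.stone \<nu>" using \<nu> by (simp add: radon_measure_def)
  then have "(\<lambda>i. \<nu> (h i)) sums \<nu> (\<Union>i. h i)" using hb hd by (rule signed_borel_measure_sums)
  ultimately have "(\<lambda>i. 0) sums \<nu> (\<Union>i. h i)" by simp
  then have "\<nu> (\<Union>i. h i) = 0" by (rule sums_unique2) (rule sums_zero)
  moreover have "fibre_difference n (\<Union>i. h i) = 1" for n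
  proof -
    have "(\<lambda>i. fibre_difference n (h i)) sums fibre_difference n (\<Union>i. h i)"
      by (rule signed_borel_measure_sums[OF fibre_pair.signed_borel_measure hb hd])
    moreover have "(\<lambda>i. fibre_difference n (h i)) sums 1"
      using sums_single[of n "\<lambda>_. 1::real"] by (simp add: val)
    ultimately show ?thesis by (rule sums_unique2)
  qed
  moreover have "(\<Union>i. h i) \<in> borel_sets_of balanced.stone"
    unfolding borel_sets_of_def
    by (intro sigma_sets.Basic CollectI openin_Union)
      (auto simp: h_def intro: balanced.openin_clop half_balanced)
  then have "(\<lambda>n. fibre_difference n (\<Union>i. h i)) \<longlonglongrightarrow> \<nu> (\<Union>i. h i)" by (rule lim)
  ultimately show False using LIMSEQ_unique[of "\<lambda>n. 1::real" 0 1] by simp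
qed

theorem corollary7p4:
  shows "\<exists>L :: nat set set topology.
    compact_space L \<and> Hausdorff_space L \<and> separable_space L \<and>
    \<not> grothendieck_property L \<and> l1_grothendieck_property L"
  using balanced.compact_stone balanced.Hausdorff_stone balanced.separable_stone[OF countableI_type]
    balanced_not_grothendieck balanced_l1_grothendieck
  by blast

end
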